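(* Let $\alpha_0$ be an even probability measure on $[-1,1]$ and let $g:[-1,1]\to\mathbb{R}$ be a bounded measurable odd function with $\operatorname{sgn}(g(\sigma))=\operatorname{sgn}(\sigma)$ such that, for all $t>0$, $$\frac{\partial^3}{\partial t^3}\log\alpha_0(e^{tg})<0.$$ Let $k$ be the smallest natural number such that $\frac{\partial^k}{\partial t^k}\log\alpha_0(e^{tg})\big|_{t=0}<0$. Let $W$ be a random variable with values in $(0,\infty)$ and $\mathbb{E}[W^2]<\infty$ which satisfies one of the following: (i) $\mathbb{E}[W^k]<\infty$; or (ii) $W$ obeys a power law with exponent $\tau\in(3,k+1]$, i.e. there exist constants $C_W>c_W>0$ and $w_0>1$ such that $c_Ww^{-(\tau-1)}\le\mathbb{P}(W>w)\le C_Ww^{-(\tau-1)}$ for all $w>w_0$. Then the critical exponents $\boldsymbol\beta$ and $\boldsymbol\delta$, defined by $$m^+(\theta,0)\asymp(\theta-\theta_c)^{\boldsymbol\beta}\ \text{ for }\theta\searrow\theta_c,\qquad m^+(\theta_c,h)\asymp h^{1/\boldsymbol\delta}\ \text{ for }h\searrow0,$$ exist and satisfy: - if $\mathbb{E}[W^k]<\infty$: $\boldsymbol\beta=1/(k-2)$ and $\boldsymbol\delta=k-1$; - if (ii) holds with $\tau\in(3,k+1)$: $\boldsymbol\beta=1/(\tau-3)$ and $\boldsymbol\delta=\tau-2$. In the boundary case where (ii) holds with $\tau=k+1$ there are logarithmic corrections: $$m^+(\theta,0)\asymp\Bigl(\frac{\theta-\theta_c}{\log(1/(\theta-\theta_c))}\Bigr)^{1/(k-2)}\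 \text{ for }\theta\searrow\theta_c,\qquad m^+(\theta_c,h)\asymp\Bigl(\frac{h}{\log(1/h)}\Bigr)^{1/(k-1)}\ \text{ for }h\searrow0.$$
   Context: For a measure $\mu$ and function $f$, $\mu(f)=\int f\,d\mu$. $\mathbb{E}^{sb}$ denotes size-biased expectation: $\mathbb{E}^{sb}[f(W)]=\mathbb{E}[Wf(W)]/\mathbb{E}[W]$. For $h\ge0$ and $m\in\mathbb{R}$ put $$\varphi_h(m)=\mathbb{E}^{sb}\left[\frac{\alpha_0(g\,e^{(Wm+h)g})}{\alpha_0(e^{(Wm+h)g})}\right],$$ which is the mean-field map of the rank-2 model with kernel $e^{\Phi(\sigma,\sigma')}=c+\theta g(\sigma)g(\sigma')$ and a priori measure $\alpha(d\sigma)\propto e^{hg(\sigma)}\alpha_0(d\sigma)$. For $\theta>0$, the critical value is defined by $1/\theta_c=\mathbb{E}^{sb}(W)\,\alpha_0(g^2)$. For $h=0$ and $\theta>\theta_c$, $m^+(\theta,0)$ denotes the unique positive solution of $m/\theta=\varphi_0(m)$; for $h>0$ and $\theta>0$, $m^+(\theta,h)$ denotes the unique nonnegative solution of $m/\theta=\varphi_h(m)$. The notation $f(x)\asymp g(x)$ means that $f(x)/g(x)$ is bounded away from $0$ and $\infty$ in the specified limit. *)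

theory Defs
  imports "HOL-Probability.Probability" "HOL-Library.Landau_Symbols"
begin

definition even_prob_measure :: "real measure \<Rightarrow> bool" where
  "even_prob_measure \<alpha>\<^sub>0 \<longleftrightarrow>
     prob_space \<alpha>\<^sub>0 \<and> sets \<alpha>\<^sub>0 = sets (restrict_space borel {-1..1}) \<and>
     distr \<alpha>\<^sub>0 \<alpha>\<^sub>0 uminus = \<alpha>\<^sub>0"

definition log_mgf :: "real measure \<Rightarrow> (real \<Rightarrow> real) \<Rightarrow> real \<Rightarrow> real" where
  "log_mgf \<alpha>\<^sub>0 g t = ln (\<integral>\<sigma>. exp (t * g \<sigma>) \<partial>\<alpha>\<^sub>0)"

definition size_biased :: "'w measure \<Rightarrow> ('w \<Rightarrow> real) \<Rightarrow> (real \<Rightarrow> real) \<Rightarrow> real" where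
  "size_biased M W f = (\<integral>\<omega>. W \<omega> * f (W \<omega>) \<partial>M) / (\<integral>\<omega>. W \<omega> \<partial>M)"

definition mean_field_map ::
  "real measure \<Rightarrow> (real \<Rightarrow> real) \<Rightarrow> 'w measure \<Rightarrow> ('w \<Rightarrow> real) \<Rightarrow> real \<Rightarrow> real \<Rightarrow> real" where
  "mean_field_map \<alpha>\<^sub>0 g M W h m = size_biased M W
     (\<lambda>w. (\<integral>\<sigma>. g \<sigma> * exp ((w * m + h) * g \<sigma>) \<partial>\<alpha>\<^sub>0) /
          (\<integral>\<sigma>. exp ((w * m + h) * g \<sigma>) \<partial>\<alpha>\<^sub>0))"

definition theta_c ::
  "real measure \<Rightarrow> (real \<Rightarrow> real) \<Rightarrow> 'w measure \<Rightarrow> ('w \<Rightarrow> real) \<Rightarrow> real" where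
  "theta_c \<alpha>\<^sub>0 g M W = 1 / (size_biased M W (\<lambda>w. w) * (\<integral>\<sigma>. (g \<sigma>)\<^sup>2 \<partial>\<alpha>\<^sub>0))"

text \<open>
  For \<open>h = 0\<close> the value is meaningful for \<open>\<theta> > \<theta>\<^sub>c\<close> only, where \<open>0\<close> is a further
  solution that has to be excluded; for \<open>h > 0\<close> it is meaningful for all \<open>\<theta> > 0\<close>.
\<close>

definition m_plus ::
  "real measure \<Rightarrow> (real \<Rightarrow> real) \<Rightarrow> 'w measure \<Rightarrow> ('w \<Rightarrow> real) \<Rightarrow> real \<Rightarrow> real \<Rightarrow> real" where
  "m_plus \<alpha>\<^sub>0 g M W \<theta> h =
     (if h = 0 then (THE m. m > 0 \<and> m / \<theta> = mean_field_map \<alpha>\<^sub>0 g M W 0 m)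
      else (THE m. m \<ge> 0 \<and> m / \<theta> = mean_field_map \<alpha>\<^sub>0 g M W h m))"

definition power_law :: "'w measure \<Rightarrow> ('w \<Rightarrow> real) \<Rightarrow> real \<Rightarrow> bool" where
  "power_law M W \<tau> \<longleftrightarrow>
     (\<exists>c C w\<^sub>0. 0 < c \<and> c < C \<and> 1 < w\<^sub>0 \<and>
        (\<forall>w>w\<^sub>0. c * w powr (- (\<tau> - 1)) \<le> measure M {\<omega> \<in> space M. W \<omega> > w} \<and>
                 measure M {\<omega> \<in> space M. W \<omega> > w} \<le> C * w powr (- (\<tau> - 1))))"

text \<open>The relation \<open>\<asymp>\<close> is membership in \<open>\<Theta>\<close> for the one-sided limit in question.\<close>

definition is_beta_exponent ::
  "real measure \<Rightarrow> (real \<Rightarrow> real) \<Rightarrow> 'w measure \<Rightarrow> ('w \<Rightarrow> real) \<Rightarrow> real \<Rightarrow> bool" where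
  "is_beta_exponent \<alpha>\<^sub>0 g M W \<beta> \<longleftrightarrow>
     (\<lambda>\<theta>. m_plus \<alpha>\<^sub>0 g M W \<theta> 0) \<in> \<Theta>[at_right (theta_c \<alpha>\<^sub>0 g M W)](\<lambda>\<theta>. (\<theta> - theta_c \<alpha>\<^sub>0 g M W) powr \<beta>)"

definition is_delta_exponent ::
  "real measure \<Rightarrow> (real \<Rightarrow> real) \<Rightarrow> 'w measure \<Rightarrow> ('w \<Rightarrow> real) \<Rightarrow> real \<Rightarrow> bool" where
  "is_delta_exponent \<alpha>\<^sub>0 g M W \<delta> \<longleftrightarrow>
     (\<lambda>h. m_plus \<alpha>\<^sub>0 g M W (theta_c \<alpha>\<^sub>0 g M W) h) \<in> \<Theta>[at_right 0](\<lambda>h. h powr (1 / \<delta>))"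

end

theory Submission imports Defs "HOL-Real_Asymp.Real_Asymp" begin

text \<open>
  Write \<open>L\<close> for the logarithmic moment generating function, \<open>L\<^sub>1\<close> and \<open>L\<^sub>2\<close> for its first two
  derivatives, and \<open>R t = L\<^sub>2 0 * t - L\<^sub>1 t\<close>. Since the third derivative of \<open>L\<close> is negative on
  \<open>(0, \<infinity>)\<close>, the functions \<open>R t\<close> and \<open>R t / t\<close> are strictly increasing there, and
  \<open>R t \<asymp> t * min (t ^ (k - 2)) 1\<close> by Taylor's formula at \<open>0\<close>. The mean-field equations become
  \<open>E\<^sup>s\<^sup>b (R (W * m)) = m * (1 / \<theta>\<^sub>c - 1 / \<theta>)\<close> for \<open>h = 0\<close> and
  \<open>E\<^sup>s\<^sup>b (R (W * m + h)) = L\<^sub>2 0 * h\<close> for \<open>\<theta> = \<theta>\<^sub>c\<close>. Both left-hand sides are comparable to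
  \<open>m * T m\<close> with \<open>T m = E (W\<^sup>2 * min ((W * m) ^ (k - 2)) 1)\<close>, up to a term \<open>O (h ^ (k - 1))\<close> that
  is negligible against \<open>h\<close>. Hence \<open>T m\<^sup>+ \<asymp> \<theta> - \<theta>\<^sub>c\<close> and \<open>m\<^sup>+ * T m\<^sup>+ \<asymp> h\<close>, and the exponents are
  read off from the behaviour of \<open>T\<close> at \<open>0\<close>, which is \<open>m ^ (k - 2)\<close>, \<open>m powr (\<tau> - 3)\<close> or
  \<open>m ^ (k - 2) * ln (1 / m)\<close> in the three cases.
\<close>

text \<open>A Taylor expansion of \<open>R\<close> at \<open>0\<close> alone does not suffice:
  \<open>W\<close> may be unbounded, so \<open>W * m\<close> need not be small when \<open>m\<close>
  is. The two-sided bound on \<open>R\<close> therefore has to hold on the whole half-line. The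
  truncation by \<open>1\<close> in it reflects that \<open>R\<close> grows linearly at infinity,
  above because \<open>L\<^sub>1\<close> is nonnegative there and below because
  \<open>R t / t\<close> increases. This linear growth is what makes a finite second moment of
  \<open>W\<close> enough for all expectations involved. Monotonicity has two uses. It gives
  uniqueness of the solutions: that of \<open>R\<close> for \<open>h > 0\<close>, that of
  \<open>R t / t\<close> for \<open>h = 0\<close>, where division by \<open>m\<close> discards the
  trivial solution. Through the monotonicity of \<open>T\<close> it also shows that the solutions
  tend to \<open>0\<close>, which must be known before the behaviour of \<open>T\<close> at
  \<open>0\<close> can be used. The number \<open>k\<close> marks the first negative derivative, so
  the vanishing of those between the second and the \<open>k\<close>-th has to be proved. That an
  exponent exists is stated as an equivalence, which also requires its uniqueness.\<close>

section \<open>The logarithmic moment generating function\<close>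

text \<open>Applied below with \<open>u n\<close> the n-th exponential moment divided by the 0-th.
  The derivatives of these quotients are polynomials in the quotients, so every iterate of the total
  operator \<open>deriv\<close> is a genuine derivative, without an explicit formula for it.\<close>

inductive_set poly_closure :: "(nat \<Rightarrow> real \<Rightarrow> real) \<Rightarrow> (real \<Rightarrow> real) set" for u where
  gen: "u n \<in> poly_closure u"
| const: "(\<lambda>_. c) \<in> poly_closure u"
| add: "f \<in> poly_closure u \<Longrightarrow> f' \<in> poly_closure u \<Longrightarrow> (\<lambda>t. f t + f' t) \<in> poly_closure u"
| mult: "f \<in> poly_closure u \<Longrightarrow> f' \<in> poly_closure u \<Longrightarrow> (\<lambda>t. f t * f' t) \<in> poly_closure u"

lemma poly_closure_deriv:
  assumes u: "\<And>n. \<exists>d\<in>poly_closure u. \<forall>t. (u n has_real_derivative d t) (at t)"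
    and "f \<in> poly_closure u"
  shows "\<exists>d\<in>poly_closure u. \<forall>t. (f has_real_derivative d t) (at t)"
  using assms(2)
proof induction
  case (gen n)
  show ?case by (rule u)
next
  case (const c)
  show ?case by (rule bexI[of _ "\<lambda>_. 0"]) (auto intro: poly_closure.const)
next
  case (add f f')
  then obtain d d' where "d \<in> poly_closure u" "d' \<in> poly_closure u"
    "\<And>t. (f has_real_derivative d t) (at t)" "\<And>t. (f' has_real_derivative d' t) (at t)" by blast
  then show ?case
    by (intro bexI[of _ "\<lambda>t. d t + d' t"]) (auto intro!: poly_closure.add DERIV_add)
next
  case (mult f f')
  then obtain d d' where d: "d \<in> poly_closure u" "d' \<in> poly_closure u"
    "\<And>t. (f has_real_derivative d t) (at t)" "\<And>t. (f' has_real_derivative d' t) (at t)" by blast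
  then have "((\<lambda>t. f t * f' t) has_real_derivative d t * f' t + f t * d' t) (at t)" for t
    by (auto intro!: derivative_eq_intros)
  with mult d show ?case
    by (intro bexI[of _ "\<lambda>t. d t * f' t + f t * d' t"])
       (auto intro!: poly_closure.add poly_closure.mult)
qed

lemma poly_closure_higher_deriv:
  assumes u: "\<And>n. \<exists>d\<in>poly_closure u. \<forall>t. (u n has_real_derivative d t) (at t)"
    and f: "f \<in> poly_closure u"
  shows "(deriv ^^ n) f \<in> poly_closure u"
proof (induction n)
  case 0
  show ?case using f by simp
next
  case (Suc n)
  from poly_closure_deriv[OF u Suc.IH] obtain d where
    "d \<in> poly_closure u" "\<And>t. ((deriv ^^ n) f has_real_derivative d t) (at t)" by blast
  then have "d \<in> poly_closure u" "deriv ((deriv ^^ n) f) = d"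
    by (auto intro: DERIV_imp_deriv)
  then show ?case by simp
qed

text \<open>Unnormalised moments of \<open>g\<close> under the exponentially tilted measure.
  Differentiating in \<open>t\<close> raises \<open>n\<close> by one.\<close>

definition exp_moment :: "real measure \<Rightarrow> (real \<Rightarrow> real) \<Rightarrow> nat \<Rightarrow> real \<Rightarrow> real" where
  "exp_moment A g n t = (\<integral>\<sigma>. g \<sigma> ^ n * exp (t * g \<sigma>) \<partial>A)"

locale bounded_observable = prob_space A for A :: "real measure" +
  fixes g :: "real \<Rightarrow> real" and B :: real
  assumes g_measurable [measurable]: "g \<in> borel_measurable A"
    and g_bounded: "\<And>\<sigma>. \<sigma> \<in> space A \<Longrightarrow> \<bar>g \<sigma>\<bar> \<le> B"
begin

lemma B_nonneg: "0 \<le> B"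
proof -
  obtain \<sigma> where "\<sigma> \<in> space A" using not_empty by blast
  from g_bounded[OF this] show ?thesis by linarith
qed

lemma exp_le: "\<sigma> \<in> space A \<Longrightarrow> exp (t * g \<sigma>) \<le> exp (\<bar>t\<bar> * B)"
  by (metis (no_types, opaque_lifting) abs_ge_self abs_ge_zero abs_mult exp_le_cancel_iff g_bounded mult_left_mono order_trans)

lemma integrable_exp_moment [simp]: "integrable A (\<lambda>\<sigma>. g \<sigma> ^ n * exp (t * g \<sigma>))"
proof (rule integrable_const_bound[where B = "B ^ n * exp (\<bar>t\<bar> * B)"])
  show "AE \<sigma> in A. norm (g \<sigma> ^ n * exp (t * g \<sigma>)) \<le> B ^ n * exp (\<bar>t\<bar> * B)"
    using B_nonneg by (auto simp: abs_mult power_abs intro!: mult_mono power_mono g_bounded exp_le)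
qed simp

lemma exp_moment_0_pos: "0 < exp_moment A g 0 t"
proof -
  have "0 < (\<integral>\<sigma>. exp (- (\<bar>t\<bar> * B)) \<partial>A)" by (simp add: prob_space)
  also have "\<dots> \<le> (\<integral>\<sigma>. g \<sigma> ^ 0 * exp (t * g \<sigma>) \<partial>A)"
  proof (rule integral_mono)
    fix \<sigma> assume "\<sigma> \<in> space A"
    from exp_le[OF this, of "- t"] show "exp (- (\<bar>t\<bar> * B)) \<le> g \<sigma> ^ 0 * exp (t * g \<sigma>)"
      by (simp add: exp_minus divide_simps mult.commute)
  qed (use integrable_exp_moment[of 0 t] in auto)
  finally show ?thesis by (simp add: exp_moment_def)
qed

text \<open>The Lagrange remainder of order two, with the intermediate point moved out to the
  absolute value of \<open>x\<close>. It gives a pointwise error that is quadratic in the increment,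
  from which differentiation under the integral follows directly.\<close>

lemma exp_remainder_bound: "\<bar>exp x - 1 - x\<bar> \<le> exp \<bar>x\<bar> * x\<^sup>2" for x :: real
proof -
  obtain t where t: "\<bar>t\<bar> \<le> \<bar>x\<bar>" "exp x = (\<Sum>m<2. x ^ m / fact m) + exp t / fact 2 * x ^ 2"
    using Maclaurin_exp_le[of x 2] by blast
  then have "\<bar>exp x - 1 - x\<bar> = exp t / 2 * x\<^sup>2" by (simp add: numeral_2_eq_2 abs_mult)
  moreover have "exp t / 2 \<le> exp \<bar>x\<bar>"
    using t(1) by (smt (verit) exp_gt_zero exp_le_cancel_iff field_sum_of_halves)
  ultimately show ?thesis
    using mult_right_mono[of "exp t / 2" "exp \<bar>x\<bar>" "x\<^sup>2"] by simp
qed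

lemma exp_moment_deriv: "(exp_moment A g n has_real_derivative exp_moment A g (Suc n) t) (at t)"
proof -
  \<comment> \<open>The first two factors bound
    \<open>g \<sigma> ^ n * exp (t * g \<sigma>)\<close>; the last one comes from the exponential
    remainder at \<open>h * g \<sigma>\<close> for increments of modulus at most
    \<open>1\<close>.\<close>
  let ?K = "B ^ n * exp (\<bar>t\<bar> * B) * (exp B * B\<^sup>2)"
  let ?D = "\<lambda>h \<sigma>. g \<sigma> ^ n * exp ((t + h) * g \<sigma>) - g \<sigma> ^ n * exp (t * g \<sigma>)
                    - h * (g \<sigma> ^ Suc n * exp (t * g \<sigma>))"
  have bound: "\<bar>exp_moment A g n (t + h) - exp_moment A g n t - h * exp_moment A g (Suc n) t\<bar>
      \<le> ?K * h\<^sup>2" if h: "\<bar>h\<bar> \<le> 1" for h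
  proof -
    have "\<bar>?D h \<sigma>\<bar> \<le> ?K * h\<^sup>2" if s: "\<sigma> \<in> space A" for \<sigma>
    proof -
      have "?D h \<sigma> = g \<sigma> ^ n * exp (t * g \<sigma>) * (exp (h * g \<sigma>) - 1 - h * g \<sigma>)"
        by (simp add: algebra_simps exp_add)
      moreover have "\<bar>exp (h * g \<sigma>) - 1 - h * g \<sigma>\<bar> \<le> exp \<bar>h * g \<sigma>\<bar> * (h * g \<sigma>)\<^sup>2"
        by (rule exp_remainder_bound)
      moreover have "exp \<bar>h * g \<sigma>\<bar> * (h * g \<sigma>)\<^sup>2 \<le> exp B * (h\<^sup>2 * B\<^sup>2)"
      proof (rule mult_mono)
        have "\<bar>h\<bar> * \<bar>g \<sigma>\<bar> \<le> 1 * B" using h g_bounded[OF s] by (intro mult_mono) auto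
        then show "exp \<bar>h * g \<sigma>\<bar> \<le> exp B" by (simp add: abs_mult)
        have "\<bar>g \<sigma>\<bar>\<^sup>2 \<le> B\<^sup>2" by (intro power_mono g_bounded s) auto
        then show "(h * g \<sigma>)\<^sup>2 \<le> h\<^sup>2 * B\<^sup>2" by (simp add: power_mult_distrib mult_left_mono)
      qed auto
      moreover have "\<bar>g \<sigma> ^ n * exp (t * g \<sigma>)\<bar> \<le> B ^ n * exp (\<bar>t\<bar> * B)"
        using B_nonneg s by (auto simp: abs_mult power_abs intro!: mult_mono power_mono g_bounded exp_le)
      ultimately have "\<bar>?D h \<sigma>\<bar> \<le> (B ^ n * exp (\<bar>t\<bar> * B)) * (exp B * (h\<^sup>2 * B\<^sup>2))"
        unfolding abs_mult by (metis (no_types, lifting) abs_ge_zero abs_mult mult_mono' order_trans)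
      then show ?thesis by (simp add: mult_ac)
    qed
    then have "\<bar>\<integral>\<sigma>. ?D h \<sigma> \<partial>A\<bar> \<le> (\<integral>\<sigma>. ?K * h\<^sup>2 \<partial>A)"
      by (intro order_trans[OF integral_abs_bound] integral_mono) (auto intro!: Bochner_Integration.integrable_diff integrable_mult_right integrable_exp_moment simp del: power_Suc)
    moreover have "(\<integral>\<sigma>. ?D h \<sigma> \<partial>A) = exp_moment A g n (t + h) - exp_moment A g n t - h * exp_moment A g (Suc n) t"
      unfolding exp_moment_def
      by (subst Bochner_Integration.integral_diff Bochner_Integration.integral_mult_right_zero, (auto intro!: Bochner_Integration.integrable_diff integrable_mult_right integrable_exp_moment simp del: power_Suc)[2])+ simp
    ultimately show ?thesis by (simp add: prob_space)
  qed
  have "((\<lambda>h. (exp_moment A g n (t + h) - exp_moment A g n t) / h - exp_moment A g (Suc n) t) \<longlongrightarrow> 0) (at 0)"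
  proof (rule Lim_null_comparison)
    have "\<forall>\<^sub>F h in at (0::real). \<bar>h\<bar> < 1" 
      by (rule eventually_at_ball'[of 1, THEN eventually_mono]) (auto simp: dist_real_def)
    moreover have "\<forall>\<^sub>F h in at (0::real). h \<noteq> 0" by (simp add: eventually_at_filter)
    ultimately show "\<forall>\<^sub>F h in at 0. norm ((exp_moment A g n (t + h) - exp_moment A g n t) / h
        - exp_moment A g (Suc n) t) \<le> ?K * \<bar>h\<bar>"
    proof eventually_elim
      case (elim h)
      have eq: "(exp_moment A g n (t + h) - exp_moment A g n t) / h - exp_moment A g (Suc n) t
         = (exp_moment A g n (t + h) - exp_moment A g n t - h * exp_moment A g (Suc n) t) / h"
        using elim by (simp add: field_simps)
      have quot: "\<bar>X / h\<bar> \<le> K * \<bar>h\<bar>" if "\<bar>X\<bar> \<le> K * h\<^sup>2" for X K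
      proof -
        have "\<bar>X\<bar> / \<bar>h\<bar> \<le> K * h\<^sup>2 / \<bar>h\<bar>" by (rule divide_right_mono[OF that]) simp
        also have "K * h\<^sup>2 / \<bar>h\<bar> = K * \<bar>h\<bar>"
          using elim by (cases "h > 0") (auto simp: power2_eq_square)
        finally show ?thesis by simp
      qed
      show ?case unfolding real_norm_def eq by (rule quot, rule bound) (use elim in simp)
    qed
    show "((\<lambda>h. ?K * \<bar>h\<bar>) \<longlongrightarrow> 0) (at 0)"
      using tendsto_mult_left[OF tendsto_rabs[OF tendsto_ident_at[of "0::real" UNIV]], of ?K] by simp
  qed
  then show ?thesis unfolding DERIV_def by (rule LIM_zero_cancel)
qed

lemma log_mgf_higher_deriv:
  "((deriv ^^ n) (log_mgf A g) has_real_derivative (deriv ^^ Suc n) (log_mgf A g) t) (at t)"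
  and deriv_log_mgf: "deriv (log_mgf A g) t = exp_moment A g 1 t / exp_moment A g 0 t"
  and deriv2_log_mgf: "(deriv ^^ 2) (log_mgf A g) t =
    exp_moment A g 2 t / exp_moment A g 0 t - (exp_moment A g 1 t / exp_moment A g 0 t)\<^sup>2"
proof -
  define u where "u n t = exp_moment A g n t / exp_moment A g 0 t" for n t
  have nz: "exp_moment A g 0 t \<noteq> 0" for t using exp_moment_0_pos[of t] by simp
  \<comment> \<open>The quotient rule. The difference is written with the factor \<open>- 1\<close>
    so that it is literally a member of \<open>poly_closure u\<close>.\<close>
  have du: "(u n has_real_derivative (u (Suc n) t + (- 1) * (u n t * u 1 t))) (at t)" for n t
    unfolding u_def
    by (rule DERIV_cong[OF DERIV_divide[OF exp_moment_deriv exp_moment_deriv nz]])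
       (use nz[of t] in \<open>simp add: field_simps\<close>)
  have u: "\<exists>d\<in>poly_closure u. \<forall>t. (u n has_real_derivative d t) (at t)" for n
  proof (rule bexI[of _ "\<lambda>t. u (Suc n) t + (- 1) * (u n t * u 1 t)"])
    show "(\<lambda>t. u (Suc n) t + (- 1) * (u n t * u 1 t)) \<in> poly_closure u"
      by (rule poly_closure.add[OF poly_closure.gen poly_closure.mult[OF poly_closure.const
            poly_closure.mult[OF poly_closure.gen poly_closure.gen]]])
  qed (intro allI du)
  have L: "log_mgf A g = (\<lambda>t. ln (exp_moment A g 0 t))"
    by (simp add: log_mgf_def exp_moment_def fun_eq_iff)
  have d1: "(log_mgf A g has_real_derivative u 1 t) (at t)" for t
    unfolding L u_def
    by (rule DERIV_cong[OF DERIV_chain2[OF DERIV_ln exp_moment_deriv]])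
       (use exp_moment_0_pos[of t] in \<open>simp_all add: field_simps\<close>)
  then have D1: "deriv (log_mgf A g) = u 1" by (auto intro: DERIV_imp_deriv)
  then show "deriv (log_mgf A g) t = exp_moment A g 1 t / exp_moment A g 0 t"
    by (simp add: u_def)
  have "deriv (u 1) t = u 2 t + (- 1) * (u 1 t * u 1 t)"
    using DERIV_imp_deriv[OF du[of 1 t]] by (simp add: numeral_2_eq_2)
  then show "(deriv ^^ 2) (log_mgf A g) t =
    exp_moment A g 2 t / exp_moment A g 0 t - (exp_moment A g 1 t / exp_moment A g 0 t)\<^sup>2"
    by (simp add: numeral_2_eq_2 D1 u_def power2_eq_square)
  show "((deriv ^^ n) (log_mgf A g) has_real_derivative (deriv ^^ Suc n) (log_mgf A g) t) (at t)"
  \<comment> \<open>The logarithm itself is not a polynomial in the normalised moments, only its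
    derivative \<open>u 1\<close> is; order \<open>0\<close> is therefore treated apart.\<close>
  proof (cases n)
    case 0
    with d1 D1 show ?thesis by simp
  next
    case (Suc m)
    have "(deriv ^^ n) (log_mgf A g) = (deriv ^^ m) (u 1)"
      by (simp only: Suc funpow_Suc_right o_apply D1)
    then have "(deriv ^^ n) (log_mgf A g) \<in> poly_closure u"
      using poly_closure_higher_deriv[OF u poly_closure.gen] by simp
    from poly_closure_deriv[OF u this] obtain d
      where "\<And>t. ((deriv ^^ n) (log_mgf A g) has_real_derivative d t) (at t)" by blast
    moreover from this have "deriv ((deriv ^^ n) (log_mgf A g)) t = d t" for t
      by (rule DERIV_imp_deriv)
    ultimately show ?thesis by simp
  qed
qed

text \<open>The derivative is the mean of \<open>g\<close> under the tilted probability
  measure.\<close>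

lemma deriv_log_mgf_bounded: "\<bar>deriv (log_mgf A g) t\<bar> \<le> B"
proof -
  have "\<bar>exp_moment A g 1 t\<bar> \<le> (\<integral>\<sigma>. \<bar>g \<sigma> ^ 1 * exp (t * g \<sigma>)\<bar> \<partial>A)"
    unfolding exp_moment_def by (rule integral_abs_bound)
  also have "\<dots> \<le> (\<integral>\<sigma>. B * (g \<sigma> ^ 0 * exp (t * g \<sigma>)) \<partial>A)"
  proof (rule integral_mono)
    show "integrable A (\<lambda>\<sigma>. \<bar>g \<sigma> ^ 1 * exp (t * g \<sigma>)\<bar>)"
      by (rule integrable_abs[OF integrable_exp_moment])
    show "integrable A (\<lambda>\<sigma>. B * (g \<sigma> ^ 0 * exp (t * g \<sigma>)))"
      by (rule integrable_mult_right[OF integrable_exp_moment])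
    show "\<bar>g \<sigma> ^ 1 * exp (t * g \<sigma>)\<bar> \<le> B * (g \<sigma> ^ 0 * exp (t * g \<sigma>))" if "\<sigma> \<in> space A" for \<sigma>
      using mult_right_mono[OF g_bounded[OF that], of "exp (t * g \<sigma>)"] by (simp add: abs_mult)
  qed
  also have "\<dots> = B * exp_moment A g 0 t" by (simp add: exp_moment_def)
  finally show ?thesis
    using exp_moment_0_pos[of t] by (simp add: deriv_log_mgf pos_divide_le_eq)
qed

text \<open>For \<open>t \<ge> 0\<close> tilting increases
  \<open>g \<sigma> * exp (t * g \<sigma>)\<close> pointwise, whatever the sign of
  \<open>g \<sigma>\<close>, and the untilted mean is \<open>0\<close>.\<close>

lemma deriv_log_mgf_nonneg:
  assumes "(\<integral>\<sigma>. g \<sigma> \<partial>A) = 0" "0 \<le> t"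
  shows "0 \<le> deriv (log_mgf A g) t"
proof -
  have "(\<integral>\<sigma>. g \<sigma> ^ 1 * exp (0 * g \<sigma>) \<partial>A) \<le> (\<integral>\<sigma>. g \<sigma> ^ 1 * exp (t * g \<sigma>) \<partial>A)"
  proof (intro integral_mono integrable_exp_moment)
    fix \<sigma>
    show "g \<sigma> ^ 1 * exp (0 * g \<sigma>) \<le> g \<sigma> ^ 1 * exp (t * g \<sigma>)"
    proof (cases "0 \<le> g \<sigma>")
      case True
      then show ?thesis using assms(2) mult_left_mono[of 1 "exp (t * g \<sigma>)" "g \<sigma>"] by simp
    next
      case False
      then show ?thesis
        using assms(2) mult_left_mono_neg[of "exp (t * g \<sigma>)" 1 "g \<sigma>"]
        by (simp add: mult_nonneg_nonpos)
    qed
  qed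
  with assms(1) have "0 \<le> exp_moment A g 1 t" by (simp add: exp_moment_def)
  then show ?thesis using exp_moment_0_pos[of t] by (simp add: deriv_log_mgf)
qed

end

section \<open>The remainder of the response function\<close>

text \<open>\<open>\<kappa> n\<close> stands for the n-th derivative of \<open>L\<close>. From here
  on only the chain of derivatives and its signs matter, not the measure behind them.\<close>

locale response =
  fixes \<kappa> :: "nat \<Rightarrow> real \<Rightarrow> real" and k :: nat
  assumes kappa_deriv: "\<And>n t. (\<kappa> n has_real_derivative \<kappa> (Suc n) t) (at t)"
    and kappa1_0: "\<kappa> 1 0 = 0"
    and kappa1_nonneg: "\<And>t. 0 \<le> t \<Longrightarrow> 0 \<le> \<kappa> 1 t"
    and kappa3_neg: "\<And>t. 0 < t \<Longrightarrow> \<kappa> 3 t < 0"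
    and kappa_k_neg: "\<kappa> k 0 < 0"
    and kappa_nonneg: "\<And>j. j < k \<Longrightarrow> 0 \<le> \<kappa> j 0"
    and k_ge_3: "3 \<le> k"
begin

definition rem :: "real \<Rightarrow> real" where "rem t = \<kappa> 2 0 * t - \<kappa> 1 t"

lemma kappa_tendsto: "(\<kappa> n \<longlongrightarrow> \<kappa> n 0) (at 0)"
  using DERIV_isCont[OF kappa_deriv] by (simp add: isCont_def)

lemma kappa_near_0:
  assumes "l < \<kappa> n 0" "\<kappa> n 0 < u"
  obtains d where "0 < d" "\<And>t. \<bar>t\<bar> < d \<Longrightarrow> l < \<kappa> n t \<and> \<kappa> n t < u"
proof -
  have "\<forall>\<^sub>F t in at 0. l < \<kappa> n t \<and> \<kappa> n t < u"
    using order_tendstoD[OF kappa_tendsto] assms by (auto intro: eventually_conj)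
  then obtain d where "0 < d" "\<And>t. t \<noteq> 0 \<Longrightarrow> \<bar>t\<bar> < d \<Longrightarrow> l < \<kappa> n t \<and> \<kappa> n t < u"
    by (auto simp: eventually_at dist_real_def)
  with that[of d] assms show thesis by metis
qed

text \<open>A positive \<open>\<kappa> j 0\<close> as first nonvanishing derivative would make \<open>\<kappa> 3\<close> positive
  to the right of \<open>0\<close>, by Taylor's formula.\<close>

lemma kappa_eq_0: "3 \<le> j \<Longrightarrow> j < k \<Longrightarrow> \<kappa> j 0 = 0"
proof (induction j rule: less_induct)
  case (less j)
  show ?case
  proof (rule ccontr)
    assume "\<kappa> j 0 \<noteq> 0"
    with kappa_nonneg[OF less.prems(2)] have "0 < \<kappa> j 0" by simp
    then obtain d where d: "0 < d" "\<And>t. \<bar>t\<bar> < d \<Longrightarrow> 0 < \<kappa> j t"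
      using kappa_near_0[of 0 j "\<kappa> j 0 + 1"] by (metis less_add_one)
    define h where "h = d / 2"
    have h: "0 < h" "h < d" using d by (auto simp: h_def)
    have "0 < \<kappa> 3 h"
    proof (cases "j = 3")
      case True
      then show ?thesis using d(2)[of h] h by simp
    next
      case False
      \<comment> \<open>Taylor's formula is applied to \<open>\<kappa> 3\<close>, which shifts all
        indices by 3. It requires a positive order, hence the separate case \<open>j = 3\<close>,
        where the sign is immediate.\<close>
      have "\<forall>m t. m < j - 3 \<and> 0 \<le> t \<and> t \<le> h \<longrightarrow>
          (\<kappa> (m + 3) has_real_derivative \<kappa> (Suc m + 3) t) (at t)"
        using kappa_deriv[of "_ + 3"] by (simp only: add_Suc simp_thms)
      with False obtain t where t: "0 < t" "t < h"
        "\<kappa> 3 h = (\<Sum>m<j - 3. \<kappa> (m + 3) 0 / fact m * h ^ m) + \<kappa> (j - 3 + 3) t / fact (j - 3) * h ^ (j - 3)"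
        using Maclaurin[of h "j - 3" "\<lambda>m. \<kappa> (m + 3)" "\<kappa> 3"] less.prems(1) h(1) by auto
      have "(\<Sum>m<j - 3. \<kappa> (m + 3) 0 / fact m * h ^ m) = 0"
        using less.IH less.prems by (intro sum.neutral) auto
      with t d(2)[of t] h less.prems(1) show ?thesis by simp
    qed
    with kappa3_neg[OF h(1)] show False by simp
  qed
qed

lemma rem_0 [simp]: "rem 0 = 0"
  using kappa1_0 by (simp add: rem_def)

lemma rem_deriv: "(rem has_real_derivative \<kappa> 2 0 - \<kappa> 2 t) (at t)"
proof -
  have "(\<kappa> 1 has_real_derivative \<kappa> 2 t) (at t)"
    using kappa_deriv[of 1 t] by (simp add: numeral_2_eq_2)
  then show ?thesis unfolding rem_def by (auto intro!: derivative_eq_intros)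
qed

lemma rem_continuous: "continuous_on S rem"
  by (rule continuous_at_imp_continuous_on) (blast intro: DERIV_isCont rem_deriv)

text \<open>The mean-value point lies strictly to the right of \<open>s\<close>, so the sign of
  \<open>\<kappa> 3\<close> is available there even for \<open>s = 0\<close>.\<close>

lemma kappa2_strict_antimono:
  assumes "0 \<le> s" "s < t" shows "\<kappa> 2 t < \<kappa> 2 s"
proof -
  have "(\<kappa> 2 has_real_derivative \<kappa> 3 x) (at x)" for x
    using kappa_deriv[of 2 x] by (simp add: numeral_2_eq_2 numeral_3_eq_3)
  then obtain z where "s < z" "\<kappa> 2 t - \<kappa> 2 s = (t - s) * \<kappa> 3 z"
    using MVT2[OF assms(2), of "\<kappa> 2" "\<kappa> 3"] by blast
  with assms kappa3_neg[of z] show ?thesis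
    using mult_pos_neg[of "t - s" "\<kappa> 3 z"] by auto
qed

lemma rem_strict_mono:
  assumes "0 \<le> s" "s < t" shows "rem s < rem t"
proof -
  obtain z where "s < z" "rem t - rem s = (t - s) * (\<kappa> 2 0 - \<kappa> 2 z)"
    using MVT2[OF assms(2), of rem "\<lambda>x. \<kappa> 2 0 - \<kappa> 2 x"] rem_deriv by blast
  with assms kappa2_strict_antimono[of 0 z] show ?thesis
    using mult_pos_pos[of "t - s" "\<kappa> 2 0 - \<kappa> 2 z"] by linarith
qed

lemma rem_mono: "0 \<le> s \<Longrightarrow> s \<le> t \<Longrightarrow> rem s \<le> rem t"
  using rem_strict_mono[of s t] by (cases "s = t") auto

lemma rem_pos: "0 < t \<Longrightarrow> 0 < rem t"
  using rem_strict_mono[of 0 t] by simp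

lemma rem_nonneg: "0 \<le> t \<Longrightarrow> 0 \<le> rem t"
  using rem_mono[of 0 t] by simp

text \<open>\<open>rem\<close> is strictly convex on the half-line and vanishes at \<open>0\<close>.
  Its chord slope over \<open>[0, s]\<close> is the derivative at some \<open>a < s\<close>, which
  is smaller than the one over \<open>[s, t]\<close>, the derivative at some
  \<open>b > s\<close>.\<close>

lemma rem_slope_strict_mono:
  assumes "0 < s" "s < t" shows "rem s / s < rem t / t"
proof -
  obtain a where a: "0 < a" "a < s" "rem s - rem 0 = (s - 0) * (\<kappa> 2 0 - \<kappa> 2 a)"
    using MVT2[OF assms(1), of rem "\<lambda>x. \<kappa> 2 0 - \<kappa> 2 x"] rem_deriv by blast
  obtain b where b: "s < b" "rem t - rem s = (t - s) * (\<kappa> 2 0 - \<kappa> 2 b)"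
    using MVT2[OF assms(2), of rem "\<lambda>x. \<kappa> 2 0 - \<kappa> 2 x"] rem_deriv by blast
  have "\<kappa> 2 b < \<kappa> 2 a" using a b by (intro kappa2_strict_antimono) auto
  with assms have "(t - s) * (\<kappa> 2 0 - \<kappa> 2 a) < (t - s) * (\<kappa> 2 0 - \<kappa> 2 b)" by simp
  with assms b have "s * ((t - s) * (\<kappa> 2 0 - \<kappa> 2 a)) < s * (rem t - rem s)" by simp
  moreover have "s * ((t - s) * (\<kappa> 2 0 - \<kappa> 2 a)) = (t - s) * rem s" using a by simp
  ultimately show ?thesis using assms by (simp add: field_simps)
qed

lemma rem_le: "0 \<le> t \<Longrightarrow> rem t \<le> \<kappa> 2 0 * t"
  using kappa1_nonneg[of t] by (simp add: rem_def)

text \<open>Nondegeneracy of \<open>g\<close> is read off from the sign conditions: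
  \<open>0 < rem 1 \<le> \<kappa> 2 0\<close>.\<close>

lemma kappa2_pos: "0 < \<kappa> 2 0"
  using rem_pos[of 1] rem_le[of 1] by simp

text \<open>All derivatives of \<open>rem\<close> at \<open>0\<close> of order below
  \<open>k - 1\<close> vanish: the linear term was subtracted, and the rest is
  \<open>kappa_eq_0\<close>. Only the Lagrange remainder survives.\<close>

lemma rem_taylor:
  assumes "0 < t"
  obtains s where "0 < s" "s < t" "rem t = - \<kappa> k s / fact (k - 1) * t ^ (k - 1)"
proof -
  \<comment> \<open>The successive derivatives of \<open>rem\<close>. The linear term enters only
    those of order 0 and 1, and index \<open>m\<close> corresponds to
    \<open>\<kappa> (Suc m)\<close>.\<close>
  define D where "D m = (if m = 0 then rem else if m = 1 then (\<lambda>t. \<kappa> 2 0 - \<kappa> 2 t)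
    else (\<lambda>t. - \<kappa> (Suc m) t))" for m
  have "(D m has_real_derivative D (Suc m) t) (at t)" for m t
  proof -
    consider "m = 0" | "m = 1" | "2 \<le> m" by linarith
    then show ?thesis
      using kappa_deriv[of "Suc m" t] rem_deriv
      by cases (auto simp: D_def numeral_2_eq_2 intro!: derivative_eq_intros)
  qed
  then obtain s where s: "0 < s" "s < t"
    "rem t = (\<Sum>m<k - 1. D m 0 / fact m * t ^ m) + D (k - 1) s / fact (k - 1) * t ^ (k - 1)"
    using Maclaurin[of t "k - 1" D rem] assms k_ge_3 by (auto simp: D_def)
  have "D m 0 = 0" if "m < k - 1" for m
    using kappa_eq_0[of "Suc m"] that by (auto simp: D_def)
  then have "(\<Sum>m<k - 1. D m 0 / fact m * t ^ m) = 0" by (intro sum.neutral) auto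
  moreover have "D (k - 1) s = - \<kappa> k s" using k_ge_3 by (auto simp: D_def)
  ultimately show thesis using s that[of s] by simp
qed

text \<open>Near \<open>0\<close> the Taylor remainder has a coefficient close to its value at
  \<open>0\<close>. Away from \<open>0\<close> both sides are linear: the lower bound uses the
  monotone slope of \<open>rem\<close>, the upper one \<open>rem_le\<close>.\<close>

lemma rem_bounds:
  obtains c C where "0 < c" "0 < C"
    "\<And>t. 0 \<le> t \<Longrightarrow> c * (t * min (t ^ (k - 2)) 1) \<le> rem t"
    "\<And>t. 0 \<le> t \<Longrightarrow> rem t \<le> C * (t * min (t ^ (k - 2)) 1)"
proof -
  \<comment> \<open>Half of the Taylor coefficient at \<open>0\<close>. As \<open>\<kappa> k\<close>
    stays between 1/2 and 3/2 of its value at \<open>0\<close>, the bounds near \<open>0\<close>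
    have coefficients \<open>a\<close> and \<open>3 * a\<close>.\<close>
  define a where "a = - \<kappa> k 0 / 2 / fact (k - 1)"
  have a: "0 < a" unfolding a_def by (intro divide_pos_pos) (use kappa_k_neg in auto)
  obtain d where d: "0 < d" "\<And>t. \<bar>t\<bar> < d \<Longrightarrow> 3 / 2 * \<kappa> k 0 < \<kappa> k t \<and> \<kappa> k t < \<kappa> k 0 / 2"
    using kappa_near_0[of "3 / 2 * \<kappa> k 0" k "\<kappa> k 0 / 2"] kappa_k_neg by auto
  \<comment> \<open>Below \<open>d\<close> for the control of \<open>\<kappa> k\<close>, and below
    \<open>1\<close> so that the minimum is the power on \<open>[0, e]\<close>.\<close>
  define e where "e = min d 1 / 2"
  have e: "0 < e" "e < d" "e < 1" using d(1) by (auto simp: e_def min_def)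
  have pow: "t * t ^ (k - 2) = t ^ (k - 1)" for t :: real
    using k_ge_3 by (simp flip: power_Suc) (simp add: Suc_diff_le numeral_2_eq_2 Suc_diff_Suc)
  have small: "a * t ^ (k - 1) \<le> rem t \<and> rem t \<le> 3 * a * t ^ (k - 1)" if t: "0 < t" "t \<le> e" for t
  proof -
    obtain s where s: "0 < s" "s < t" "rem t = - \<kappa> k s / fact (k - 1) * t ^ (k - 1)"
      using rem_taylor[OF t(1)] by blast
    have "a \<le> - \<kappa> k s / fact (k - 1)" "- \<kappa> k s / fact (k - 1) \<le> 3 * a"
      using d(2)[of s] s t e by (auto simp: a_def divide_simps)
    then show ?thesis unfolding s(3) using t by (intro conjI mult_right_mono) auto
  qed
  let ?c = "min a (rem e / e)" and ?C = "max (3 * a) (\<kappa> 2 0 / e ^ (k - 2))"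
  have lower: "?c * (t * min (t ^ (k - 2)) 1) \<le> rem t" if t: "0 \<le> t" for t
  proof (cases "t \<le> e")
    case True
    then have "min (t ^ (k - 2)) 1 = t ^ (k - 2)" using t e by (simp add: min_def power_le_one)
    moreover have "?c * t ^ (k - 1) \<le> a * t ^ (k - 1)" using t by (intro mult_right_mono) auto
    moreover have "a * t ^ (k - 1) \<le> rem t"
      using small[of t] t True k_ge_3 by (cases "t = 0") (auto simp: zero_power)
    ultimately show ?thesis by (simp only: pow)
  next
    case False
    have "?c * (t * min (t ^ (k - 2)) 1) \<le> rem e / e * (t * 1)"
      using a rem_pos[OF e(1)] e t by (intro mult_mono) (auto simp: min_def)
    also have "\<dots> \<le> rem t"
      using rem_slope_strict_mono[OF e(1), of t] False e(1) by (simp add: field_simps)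
    finally show ?thesis .
  qed
  have upper: "rem t \<le> ?C * (t * min (t ^ (k - 2)) 1)" if t: "0 \<le> t" for t
  proof (cases "t \<le> e")
    case True
    then have "min (t ^ (k - 2)) 1 = t ^ (k - 2)" using t e by (simp add: min_def power_le_one)
    moreover have "3 * a * t ^ (k - 1) \<le> ?C * t ^ (k - 1)" using t by (intro mult_right_mono) auto
    moreover have "rem t \<le> 3 * a * t ^ (k - 1)"
      using small[of t] t True k_ge_3 by (cases "t = 0") (auto simp: zero_power)
    ultimately show ?thesis by (simp only: pow)
  next
    case False
    \<comment> \<open>Beyond \<open>e\<close> the truncated power is bounded below by
      \<open>e ^ (k - 2)\<close>, which is compensated by the denominator in
      \<open>?C\<close>.\<close>
    have "e ^ (k - 2) \<le> min (t ^ (k - 2)) 1"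
      using e False by (auto intro!: power_mono power_le_one)
    then have "\<kappa> 2 0 / e ^ (k - 2) * (t * e ^ (k - 2)) \<le> ?C * (t * min (t ^ (k - 2)) 1)"
      using t e kappa2_pos by (intro mult_mono) (auto simp: le_max_iff_disj)
    then show ?thesis using rem_le[OF t] e by simp
  qed
  show thesis
  proof (rule that[of ?c ?C])
    show "0 < ?c" using a rem_pos[OF e(1)] e by simp
    show "0 < ?C" using a by simp
  qed (use lower upper in auto)
qed

end

section \<open>Truncated moments of the weight\<close>

locale weight = prob_space M for M :: "'w measure" +
  fixes W :: "'w \<Rightarrow> real"
  assumes W_measurable [measurable]: "W \<in> borel_measurable M"
    and W_pos: "\<And>\<omega>. \<omega> \<in> space M \<Longrightarrow> 0 < W \<omega>"
    and W2_integrable: "integrable M (\<lambda>\<omega>. W \<omega> ^ 2)"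
begin

text \<open>The function \<open>T\<close> of the overview. One factor \<open>W\<close> comes from
  size biasing, the other from the linear factor in the bounds on \<open>R (W * m)\<close>.\<close>

definition truncated_moment :: "nat \<Rightarrow> real \<Rightarrow> real" where
  "truncated_moment p m = (\<integral>\<omega>. W \<omega> ^ 2 * min ((W \<omega> * m) ^ p) 1 \<partial>M)"

lemma integrable_W: "integrable M W"
  by (rule square_integrable_imp_integrable) (use W2_integrable in auto)

text \<open>Turns strict pointwise inequalities into strict inequalities between expectations;
  strict monotonicity of the averaged equations, and hence uniqueness, relies on it.\<close>

lemma expectation_pos:
  assumes "integrable M f" "\<And>\<omega>. \<omega> \<in> space M \<Longrightarrow> 0 < f \<omega>"
  shows "0 < (\<integral>\<omega>. f \<omega> \<partial>M :: real)"
proof -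
  have "\<not> (AE \<omega> in M. f \<omega> = 0)"
  proof
    assume "AE \<omega> in M. f \<omega> = 0"
    then have "AE \<omega> in M. False" by (rule AE_mp) (use assms(2) in \<open>force intro!: AE_I2\<close>)
    then show False using AE_False by blast
  qed
  moreover have "0 \<le> (\<integral>\<omega>. f \<omega> \<partial>M)"
    using assms(2) by (intro integral_nonneg_AE AE_I2) (auto intro: less_imp_le)
  ultimately show ?thesis
    using integral_nonneg_eq_0_iff_AE[OF assms(1)] assms(2)
    by (metis (no_types, lifting) AE_I2 less_eq_real_def)
qed

lemma mean_pos: "0 < (\<integral>\<omega>. W \<omega> \<partial>M)"
  by (rule expectation_pos[OF integrable_W W_pos])

lemma truncated_integrable:
  assumes "0 \<le> m" shows "integrable M (\<lambda>\<omega>. W \<omega> ^ 2 * min ((W \<omega> * m) ^ p) 1)"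
proof (rule Bochner_Integration.integrable_bound[OF W2_integrable])
  show "AE \<omega> in M. norm (W \<omega> ^ 2 * min ((W \<omega> * m) ^ p) 1) \<le> norm (W \<omega> ^ 2)"
    using assms W_pos by (intro AE_I2) (auto simp: abs_mult less_imp_le intro!: mult_left_le)
qed simp

lemma truncated_moment_pos:
  assumes "0 < m" shows "0 < truncated_moment p m"
  unfolding truncated_moment_def
  using assms W_pos
  by (intro expectation_pos truncated_integrable mult_pos_pos) (auto simp: less_imp_neq[THEN not_sym])

lemma truncated_moment_mono:
  assumes "0 \<le> s" "s \<le> t" shows "truncated_moment p s \<le> truncated_moment p t"
  unfolding truncated_moment_def
proof (rule integral_mono)
  fix \<omega> assume "\<omega> \<in> space M"
  then have "0 < W \<omega>" by (rule W_pos)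
  then have "(W \<omega> * s) ^ p \<le> (W \<omega> * t) ^ p" using assms by (intro power_mono mult_left_mono) auto
  then show "W \<omega> ^ 2 * min ((W \<omega> * s) ^ p) 1 \<le> W \<omega> ^ 2 * min ((W \<omega> * t) ^ p) 1"
    by (intro mult_left_mono min.mono) auto
qed (use assms truncated_integrable in auto)

text \<open>Dropping the truncation gives the upper bound. For the lower bound, \<open>m < 1\<close>
  permits pulling \<open>m ^ p\<close> out of the minimum, which leaves the truncated moment at
  \<open>1\<close>.\<close>

lemma truncated_moment_integrable_case:
  assumes int: "integrable M (\<lambda>\<omega>. W \<omega> ^ (p + 2))"
  shows "truncated_moment p \<in> \<Theta>[at_right 0](\<lambda>m. m powr real p)"
proof (rule bigthetaI'[of "truncated_moment p 1" "\<integral>\<omega>. W \<omega> ^ (p + 2) \<partial>M"])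
  show "0 < truncated_moment p 1" by (rule truncated_moment_pos) simp
  show "0 < (\<integral>\<omega>. W \<omega> ^ (p + 2) \<partial>M)"
    using W_pos by (intro expectation_pos int) simp
  have "\<forall>\<^sub>F m in at_right (0::real). 0 < m \<and> m < 1"
    using eventually_at_right_real[of 0 1] by simp
  then show "\<forall>\<^sub>F m in at_right 0. truncated_moment p 1 * norm (m powr real p) \<le> norm (truncated_moment p m) \<and>
      norm (truncated_moment p m) \<le> (\<integral>\<omega>. W \<omega> ^ (p + 2) \<partial>M) * norm (m powr real p)"
  proof eventually_elim
    case (elim m)
    have "truncated_moment p 1 * m ^ p = (\<integral>\<omega>. m ^ p * (W \<omega> ^ 2 * min ((W \<omega> * 1) ^ p) 1) \<partial>M)"
      by (simp add: truncated_moment_def)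
    also have "\<dots> \<le> truncated_moment p m"
      unfolding truncated_moment_def
    proof (rule integral_mono)
      fix \<omega> assume "\<omega> \<in> space M"
      have "m ^ p * min ((W \<omega> * 1) ^ p) 1 \<le> min ((W \<omega> * m) ^ p) 1"
      proof (rule min.boundedI)
        show "m ^ p * min ((W \<omega> * 1) ^ p) 1 \<le> (W \<omega> * m) ^ p"
          using elim mult_left_mono[of "min ((W \<omega> * 1) ^ p) 1" "W \<omega> ^ p" "m ^ p"]
          by (simp add: power_mult_distrib mult.commute)
        have "m ^ p * min ((W \<omega> * 1) ^ p) 1 \<le> m ^ p * 1" using elim by (intro mult_left_mono) auto
        also have "\<dots> \<le> 1" using elim by (simp add: power_le_one)
        finally show "m ^ p * min ((W \<omega> * 1) ^ p) 1 \<le> 1" .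
      qed
      from mult_left_mono[OF this, of "W \<omega> ^ 2"]
      show "m ^ p * (W \<omega> ^ 2 * min ((W \<omega> * 1) ^ p) 1) \<le> W \<omega> ^ 2 * min ((W \<omega> * m) ^ p) 1"
        by (simp add: mult.left_commute)
    qed (use elim truncated_integrable[of 1] truncated_integrable[of m] in auto)
    finally have lower: "truncated_moment p 1 * m ^ p \<le> truncated_moment p m" .
    have "truncated_moment p m \<le> (\<integral>\<omega>. m ^ p * W \<omega> ^ (p + 2) \<partial>M)"
      unfolding truncated_moment_def
    proof (rule integral_mono)
      fix \<omega>
      have "W \<omega> ^ 2 * min ((W \<omega> * m) ^ p) 1 \<le> W \<omega> ^ 2 * (W \<omega> * m) ^ p"
        by (intro mult_left_mono) auto
      then show "W \<omega> ^ 2 * min ((W \<omega> * m) ^ p) 1 \<le> m ^ p * W \<omega> ^ (p + 2)"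
        by (simp only: power_mult_distrib power_add mult_ac)
    qed (use elim truncated_integrable[of m] int in auto)
    then have "truncated_moment p m \<le> (\<integral>\<omega>. W \<omega> ^ (p + 2) \<partial>M) * m ^ p"
      by (simp add: mult.commute)
    with lower show ?case
      using elim truncated_moment_pos[of m p] by (simp add: powr_realpow)
  qed
qed

section \<open>Truncated moments as integrals of the tail probability\<close>

definition tail :: "real \<Rightarrow> real" where "tail u = prob {\<omega> \<in> space M. u \<le> W \<omega>}"

lemma tail_measurable [measurable]: "tail \<in> borel_measurable borel"
proof -
  have "mono (\<lambda>u. - tail u)"
    unfolding tail_def by (intro monoI, simp) (intro finite_measure_mono, auto)
  then have "(\<lambda>u. - (- tail u)) \<in> borel_measurable borel"
    by (intro borel_measurable_uminus borel_measurable_mono)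
  then show ?thesis by simp
qed

text \<open>Fubini's theorem, for nonnegative integrands and so without integrability conditions.
  The closed events in \<open>tail\<close> match the intervals
  \<open>{..W \<omega>}\<close>.\<close>

lemma layer_cake:
  assumes [measurable]: "f \<in> borel_measurable borel"
  shows "(\<integral>\<^sup>+\<omega>. (\<integral>\<^sup>+u. f u * indicator {..W \<omega>} u \<partial>lborel) \<partial>M) = (\<integral>\<^sup>+u. f u * ennreal (tail u) \<partial>lborel)"
proof -
  interpret P: pair_sigma_finite M lborel by unfold_locales
  have "(\<integral>\<^sup>+\<omega>. (\<integral>\<^sup>+u. f u * indicator {..W \<omega>} u \<partial>lborel) \<partial>M)
      = (\<integral>\<^sup>+\<omega>. (\<integral>\<^sup>+u. (\<lambda>(\<omega>, u). f u * (if u \<le> W \<omega> then 1 else 0)) (\<omega>, u) \<partial>lborel) \<partial>M)"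
    by (intro nn_integral_cong) (auto simp: indicator_def)
  also have "\<dots> = (\<integral>\<^sup>+u. (\<integral>\<^sup>+\<omega>. (\<lambda>(\<omega>, u). f u * (if u \<le> W \<omega> then 1 else 0)) (\<omega>, u) \<partial>M) \<partial>lborel)"
    by (rule P.Fubini[symmetric]) measurable
  also have "\<dots> = (\<integral>\<^sup>+u. (\<integral>\<^sup>+\<omega>. f u * indicator {\<omega> \<in> space M. u \<le> W \<omega>} \<omega> \<partial>M) \<partial>lborel)"
    by (intro nn_integral_cong) (auto simp: indicator_def)
  also have "\<dots> = (\<integral>\<^sup>+u. f u * ennreal (tail u) \<partial>lborel)"
    by (intro nn_integral_cong, subst nn_integral_cmult_indicator) (auto simp: tail_def emeasure_eq_measure)
  finally show ?thesis .
qed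

text \<open>\<open>power_law\<close> speaks of strict events and \<open>tail\<close> of closed ones.
  The event \<open>u \<le> W\<close> lies between \<open>u < W\<close> and \<open>u / 2 < W\<close>;
  halving costs the factor \<open>(1 / 2) powr (1 - \<tau>)\<close>, and the threshold
  \<open>3 * w\<^sub>0\<close> keeps \<open>u / 2\<close> above \<open>w\<^sub>0\<close>.\<close>

lemma power_law_tail:
  assumes "power_law M W \<tau>"
  obtains c C w where "0 < c" "0 < C" "1 < w"
    "\<And>u. w \<le> u \<Longrightarrow> c * u powr (1 - \<tau>) \<le> tail u"
    "\<And>u. w \<le> u \<Longrightarrow> tail u \<le> C * u powr (1 - \<tau>)"
proof -
  obtain c C w\<^sub>0 where cC: "0 < c" "c < C" "1 < w\<^sub>0"
    "\<And>w. w > w\<^sub>0 \<Longrightarrow> c * w powr (- (\<tau> - 1)) \<le> measure M {\<omega> \<in> space M. W \<omega> > w}"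
    "\<And>w. w > w\<^sub>0 \<Longrightarrow> measure M {\<omega> \<in> space M. W \<omega> > w} \<le> C * w powr (- (\<tau> - 1))"
    using assms unfolding power_law_def by blast
  show thesis
  proof (rule that[of c "C * (1 / 2) powr (1 - \<tau>)" "3 * w\<^sub>0"])
    fix u assume u: "3 * w\<^sub>0 \<le> u"
    then have u': "u > w\<^sub>0" "u / 2 > w\<^sub>0" using cC(3) by auto
    have "c * u powr (1 - \<tau>) \<le> measure M {\<omega> \<in> space M. W \<omega> > u}" using cC(4)[OF u'(1)] by simp
    also have "\<dots> \<le> tail u" unfolding tail_def by (intro finite_measure_mono) auto
    finally show "c * u powr (1 - \<tau>) \<le> tail u" .
    have "tail u \<le> measure M {\<omega> \<in> space M. W \<omega> > u / 2}"
      unfolding tail_def using u' cC(3) by (intro finite_measure_mono) auto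
    also have "\<dots> \<le> C * (u * (1 / 2)) powr (1 - \<tau>)" using cC(5)[OF u'(2)] by simp
    also have "\<dots> = C * (1 / 2) powr (1 - \<tau>) * u powr (1 - \<tau>)"
      using u' cC(3) by (subst powr_mult) (auto simp: mult_ac)
    finally show "tail u \<le> C * (1 / 2) powr (1 - \<tau>) * u powr (1 - \<tau>)" .
  qed (use cC in auto)
qed

lemma nn_integral_truncated:
  "0 \<le> m \<Longrightarrow> (\<integral>\<^sup>+\<omega>. ennreal (W \<omega> ^ 2 * min ((W \<omega> * m) ^ p) 1) \<partial>M) = ennreal (truncated_moment p m)"
  unfolding truncated_moment_def
  by (intro nn_integral_eq_integral truncated_integrable AE_I2) (auto intro!: mult_nonneg_nonneg simp: W_pos less_imp_le)

text \<open>The inner integral of \<open>layer_cake\<close> for the range of weights in which the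
  truncation is inactive; used with \<open>n = Suc p\<close>, \<open>a = 1 / m\<close> and
  \<open>w\<close> the start of the power law.\<close>

lemma nn_integral_power_atMost:
  fixes w x a :: real
  assumes "0 \<le> w" "w \<le> a"
  shows "(\<integral>\<^sup>+u. ennreal (real (Suc n) * u ^ n) * indicator {w..a} u * indicator {..x} u \<partial>lborel)
    = ennreal (if w \<le> x then min a x ^ Suc n - w ^ Suc n else 0)"
proof (cases "w \<le> x")
  case True
  have "(\<integral>\<^sup>+u. ennreal (real (Suc n) * u ^ n) * indicator {w..a} u * indicator {..x} u \<partial>lborel)
    = (\<integral>\<^sup>+u. ennreal (real (Suc n) * u ^ n) * indicator {w..min a x} u \<partial>lborel)"
    by (intro nn_integral_cong) (auto simp: indicator_def)
  also have "\<dots> = ennreal (min a x ^ Suc n - w ^ Suc n)"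
  proof (rule nn_integral_FTC_Icc[where F = "\<lambda>u. u ^ Suc n"])
    show "((\<lambda>u. u ^ Suc n) has_real_derivative real (Suc n) * u ^ n) (at u)" for u
      by (rule DERIV_cong[OF DERIV_pow]) simp
  qed (use assms True in auto)
  finally show ?thesis
    using True by simp
next
  case False
  then have "(\<integral>\<^sup>+u. ennreal (real (Suc n) * u ^ n) * indicator {w..a} u * indicator {..x} u \<partial>lborel) = (\<integral>\<^sup>+(u::real). 0 \<partial>lborel)"
    by (intro nn_integral_cong) (auto simp: indicator_def)
  with False show ?thesis by simp
qed

lemma nn_integral_square_atMost:
  fixes x a :: real
  assumes "0 \<le> a"
  shows "(\<integral>\<^sup>+u. ennreal (2 * u) * indicator {a..} u * indicator {..x} u \<partial>lborel)
    = ennreal (if a \<le> x then x ^ 2 - a ^ 2 else 0)"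
proof (cases "a \<le> x")
  case True
  have "(\<integral>\<^sup>+u. ennreal (2 * u) * indicator {a..} u * indicator {..x} u \<partial>lborel)
    = (\<integral>\<^sup>+u. ennreal (2 * u) * indicator {a..x} u \<partial>lborel)"
    by (intro nn_integral_cong) (auto simp: indicator_def)
  also have "\<dots> = ennreal (x ^ 2 - a ^ 2)"
  proof (rule nn_integral_FTC_Icc[where F = "\<lambda>u. u ^ 2"])
    show "((\<lambda>u. u ^ 2) has_real_derivative 2 * u) (at u)" for u
      by (rule DERIV_cong[OF DERIV_pow]) simp
  qed (use assms True in auto)
  finally show ?thesis using True by simp
next
  case False
  then have "(\<integral>\<^sup>+u. ennreal (2 * u) * indicator {a..} u * indicator {..x} u \<partial>lborel) = (\<integral>\<^sup>+(u::real). 0 \<partial>lborel)"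
    by (intro nn_integral_cong) (auto simp: indicator_def)
  with False show ?thesis by simp
qed

text \<open>The truncated integrand dominates
  \<open>m ^ p * min (1 / m) (W \<omega>) ^ (p + 2)\<close>: there is equality up to
  \<open>1 / m\<close>, and beyond it the left side is at least \<open>(1 / m)\<^sup>2\<close>.
  Layer cake turns this power into a tail integral.\<close>

lemma truncated_moment_ge:
  assumes m: "0 < m" and w: "0 \<le> w" "w \<le> 1 / m"
  shows "ennreal (m ^ p) * (\<integral>\<^sup>+u. ennreal (real (Suc (Suc p)) * u ^ Suc p) * indicator {w..1 / m} u * ennreal (tail u) \<partial>lborel)
    \<le> ennreal (truncated_moment p m)"
proof -
  have "ennreal (m ^ p) * (\<integral>\<^sup>+u. ennreal (real (Suc (Suc p)) * u ^ Suc p) * indicator {w..1 / m} u * ennreal (tail u) \<partial>lborel)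
      = ennreal (m ^ p) * (\<integral>\<^sup>+\<omega>. ennreal (if w \<le> W \<omega> then min (1 / m) (W \<omega>) ^ Suc (Suc p) - w ^ Suc (Suc p) else 0) \<partial>M)"
    using nn_integral_power_atMost[OF w] by (subst layer_cake[symmetric]) (simp_all del: power_Suc of_nat_Suc)
  also have "\<dots> = (\<integral>\<^sup>+\<omega>. ennreal (m ^ p) * ennreal (if w \<le> W \<omega> then min (1 / m) (W \<omega>) ^ Suc (Suc p) - w ^ Suc (Suc p) else 0) \<partial>M)"
    by (rule nn_integral_cmult[symmetric]) measurable
  also have "\<dots> \<le> (\<integral>\<^sup>+\<omega>. ennreal (W \<omega> ^ 2 * min ((W \<omega> * m) ^ p) 1) \<partial>M)"
  proof (rule nn_integral_mono)
    fix \<omega> assume "\<omega> \<in> space M"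
    then have W: "0 < W \<omega>" by (rule W_pos)
    have "m ^ p * min (1 / m) (W \<omega>) ^ Suc (Suc p) \<le> W \<omega> ^ 2 * min ((W \<omega> * m) ^ p) 1"
    proof (cases "W \<omega> \<le> 1 / m")
      case True
      then have "W \<omega> * m \<le> 1" using m by (simp add: field_simps)
      then have "(W \<omega> * m) ^ p \<le> 1" using m W by (intro power_le_one) auto
      with True show ?thesis by (simp add: min_def power_mult_distrib power2_eq_square mult_ac)
    next
      case False
      then have "1 \<le> W \<omega> * m" using m by (simp add: field_simps)
      then have "1 \<le> (W \<omega> * m) ^ p" by (rule one_le_power)
      moreover have "m ^ p * (1 / m) ^ Suc (Suc p) = (1 / m) ^ 2"
        using m by (simp add: power_divide power2_eq_square)
      moreover have "(1 / m) ^ 2 \<le> W \<omega> ^ 2" using False m by (intro power_mono) auto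
      ultimately show ?thesis using False by (simp add: min_def del: power_Suc)
    qed
    moreover have "0 \<le> m ^ p * w ^ Suc (Suc p)" "0 \<le> W \<omega> ^ 2 * min ((W \<omega> * m) ^ p) 1" using w m W by auto
    ultimately have "m ^ p * (if w \<le> W \<omega> then min (1 / m) (W \<omega>) ^ Suc (Suc p) - w ^ Suc (Suc p) else 0)
       \<le> W \<omega> ^ 2 * min ((W \<omega> * m) ^ p) 1"
      by (simp add: right_diff_distrib del: power_Suc)
    then show "ennreal (m ^ p) * ennreal (if w \<le> W \<omega> then min (1 / m) (W \<omega>) ^ Suc (Suc p) - w ^ Suc (Suc p) else 0)
       \<le> ennreal (W \<omega> ^ 2 * min ((W \<omega> * m) ^ p) 1)"
      using m by (subst ennreal_mult'[symmetric]) (auto intro: ennreal_leI simp del: power_Suc)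
  qed
  also have "\<dots> = ennreal (truncated_moment p m)" using m by (intro nn_integral_truncated) auto
  finally show ?thesis .
qed

text \<open>Splits the range of \<open>W\<close> at \<open>w\<close>, where tail bounds begin, and
  at \<open>1 / m\<close>, where the truncation sets in.\<close>

lemma truncated_moment_le:
  assumes m: "0 < m" and w: "0 \<le> w" "w \<le> 1 / m"
  shows "ennreal (truncated_moment p m) \<le> ennreal (m ^ p * w ^ Suc (Suc p))
    + (ennreal (m ^ p) * (\<integral>\<^sup>+u. ennreal (real (Suc (Suc p)) * u ^ Suc p) * indicator {w..1 / m} u * ennreal (tail u) \<partial>lborel)
    + (\<integral>\<^sup>+u. ennreal (2 * u) * indicator {1 / m..} u * ennreal (tail u) \<partial>lborel))"
proof -
  \<comment> \<open>Increments of the integrand over the two outer zones. Starting from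
    \<open>m ^ p * w ^ (p + 2)\<close>, adding \<open>m ^ p * A\<close> reaches
    \<open>(1 / m)\<^sup>2\<close> at \<open>W = 1 / m\<close>, and \<open>D\<close> continues from
    there to \<open>W\<^sup>2\<close>.\<close>
  define A where "A \<omega> = (if w \<le> W \<omega> then min (1 / m) (W \<omega>) ^ Suc (Suc p) - w ^ Suc (Suc p) else 0)" for \<omega>
  define D where "D \<omega> = (if 1 / m \<le> W \<omega> then W \<omega> ^ 2 - (1 / m) ^ 2 else 0)" for \<omega>
  have [measurable]: "A \<in> borel_measurable M" "D \<in> borel_measurable M"
    unfolding A_def D_def by measurable
  have "ennreal (truncated_moment p m) = (\<integral>\<^sup>+\<omega>. ennreal (W \<omega> ^ 2 * min ((W \<omega> * m) ^ p) 1) \<partial>M)"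
    using m by (intro nn_integral_truncated[symmetric]) auto
  also have "\<dots> \<le> (\<integral>\<^sup>+\<omega>. ennreal (m ^ p * w ^ Suc (Suc p)) + (ennreal (m ^ p) * ennreal (A \<omega>) + ennreal (D \<omega>)) \<partial>M)"
  proof (rule nn_integral_mono)
    fix \<omega> assume "\<omega> \<in> space M"
    then have W: "0 < W \<omega>" by (rule W_pos)
    have pw: "W \<omega> ^ 2 * min ((W \<omega> * m) ^ p) 1 \<le> m ^ p * W \<omega> ^ Suc (Suc p)"
    proof -
      have "W \<omega> ^ 2 * min ((W \<omega> * m) ^ p) 1 \<le> W \<omega> ^ 2 * (W \<omega> * m) ^ p" by (intro mult_left_mono) auto
      then show ?thesis by (simp add: power_mult_distrib power2_eq_square mult_ac)
    qed
    have "W \<omega> ^ 2 * min ((W \<omega> * m) ^ p) 1 \<le> m ^ p * w ^ Suc (Suc p) + (m ^ p * A \<omega> + D \<omega>)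
      \<and> 0 \<le> A \<omega> \<and> 0 \<le> D \<omega>"
    proof -
      consider "W \<omega> < w" | "w \<le> W \<omega>" "W \<omega> < 1 / m" | "1 / m \<le> W \<omega>" by linarith
      then show ?thesis
      proof cases
        case 1
        then have "m ^ p * W \<omega> ^ Suc (Suc p) \<le> m ^ p * w ^ Suc (Suc p)"
          using m W by (intro mult_left_mono power_mono) auto
        with 1 w pw show ?thesis by (simp add: A_def D_def del: power_Suc)
      next
        case 2
        then have "w ^ Suc (Suc p) \<le> W \<omega> ^ Suc (Suc p)" using w by (intro power_mono) auto
        with 2 pw show ?thesis by (simp add: A_def D_def right_diff_distrib del: power_Suc)
      next
        case 3
        then have "w ^ Suc (Suc p) \<le> (1 / m) ^ Suc (Suc p)" "(1 / m) ^ 2 \<le> W \<omega> ^ 2"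
          using w m by (auto intro!: power_mono simp del: power_Suc)
        moreover have "m ^ p * (1 / m) ^ Suc (Suc p) = (1 / m) ^ 2"
          using m by (simp add: power_divide power2_eq_square)
        moreover have "W \<omega> ^ 2 * min ((W \<omega> * m) ^ p) 1 \<le> W \<omega> ^ 2 * 1" by (intro mult_left_mono) auto
        ultimately show ?thesis using 3 w by (simp add: A_def D_def right_diff_distrib del: power_Suc)
      qed
    qed
    then show "ennreal (W \<omega> ^ 2 * min ((W \<omega> * m) ^ p) 1)
      \<le> ennreal (m ^ p * w ^ Suc (Suc p)) + (ennreal (m ^ p) * ennreal (A \<omega>) + ennreal (D \<omega>))"
      using m w by (simp add: ennreal_leI ennreal_mult'[symmetric] ennreal_plus[symmetric] del: ennreal_plus power_Suc)
  qed
  also have "\<dots> = ennreal (m ^ p * w ^ Suc (Suc p)) + (ennreal (m ^ p) * (\<integral>\<^sup>+\<omega>. ennreal (A \<omega>) \<partial>M) + (\<integral>\<^sup>+\<omega>. ennreal (D \<omega>) \<partial>M))"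
    by (simp add: nn_integral_add nn_integral_cmult emeasure_space_1 del: power_Suc)
  also have "(\<integral>\<^sup>+\<omega>. ennreal (A \<omega>) \<partial>M)
      = (\<integral>\<^sup>+u. ennreal (real (Suc (Suc p)) * u ^ Suc p) * indicator {w..1 / m} u * ennreal (tail u) \<partial>lborel)"
    using nn_integral_power_atMost[OF w] by (subst layer_cake[symmetric]) (simp_all add: A_def del: power_Suc of_nat_Suc)
  also have "(\<integral>\<^sup>+\<omega>. ennreal (D \<omega>) \<partial>M) = (\<integral>\<^sup>+u. ennreal (2 * u) * indicator {1 / m..} u * ennreal (tail u) \<partial>lborel)"
    using nn_integral_square_atMost[of "1 / m"] m by (subst layer_cake[symmetric]) (simp_all add: D_def)
  finally show ?thesis .
qed

text \<open>A Chebyshev-type bound: on the event \<open>1 / m \<le> W\<close> the truncation equals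
  \<open>1\<close>. It has the right order strictly below the critical tail exponent, but misses the
  logarithm at it.\<close>

lemma truncated_moment_tail_le:
  assumes m: "0 < m" shows "(1 / m) ^ 2 * tail (1 / m) \<le> truncated_moment p m"
proof -
  have "(1 / m) ^ 2 * tail (1 / m) = (\<integral>\<omega>. (1 / m) ^ 2 * indicator {\<omega> \<in> space M. 1 / m \<le> W \<omega>} \<omega> \<partial>M)"
    by (simp add: tail_def)
  also have "\<dots> \<le> truncated_moment p m"
    unfolding truncated_moment_def
  proof (rule integral_mono)
    fix \<omega> assume "\<omega> \<in> space M"
    then have W: "0 < W \<omega>" by (rule W_pos)
    have "(1 / m) ^ 2 \<le> W \<omega> ^ 2 \<and> 1 \<le> (W \<omega> * m) ^ p" if "1 / m \<le> W \<omega>"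
      using that m by (intro conjI power_mono one_le_power) (auto simp: field_simps)
    then show "(1 / m) ^ 2 * indicator {\<omega> \<in> space M. 1 / m \<le> W \<omega>} \<omega> \<le> W \<omega> ^ 2 * min ((W \<omega> * m) ^ p) 1"
      using W m by (auto simp: indicator_def min_def)
  next
    show "integrable M (\<lambda>\<omega>. (1 / m) ^ 2 * indicator {\<omega> \<in> space M. 1 / m \<le> W \<omega>} \<omega> :: real)"
      by (intro integrable_mult_right integrable_real_indicator) (auto simp: less_top[symmetric])
  qed (use m truncated_integrable[of m] in auto)
  finally show ?thesis .
qed

text \<open>The exceptional exponent \<open>- 1\<close> occurs exactly for
  \<open>\<tau> = p + 3\<close> and is the source of the logarithmic corrections.\<close>

lemma nn_integral_powr_Icc:
  fixes w a r :: real
  assumes "0 < w" "w \<le> a"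
  shows "(\<integral>\<^sup>+u. ennreal (u powr r) * indicator {w..a} u \<partial>lborel)
    = ennreal (if r = - 1 then ln a - ln w else (a powr (r + 1) - w powr (r + 1)) / (r + 1))"
proof (cases "r = - 1")
  case True
  have "(\<integral>\<^sup>+u. ennreal (u powr r) * indicator {w..a} u \<partial>lborel) = ennreal (ln a - ln w)"
  proof (rule nn_integral_FTC_Icc[where F = ln])
    fix u assume "u \<in> {w..a}"
    then show "(ln has_real_derivative u powr r) (at u)"
      using assms True by (auto intro!: derivative_eq_intros simp: powr_minus_divide)
  qed (use assms in auto)
  with True show ?thesis by simp
next
  case False
  have "(\<integral>\<^sup>+u. ennreal (u powr r) * indicator {w..a} u \<partial>lborel)
      = ennreal (a powr (r + 1) / (r + 1) - w powr (r + 1) / (r + 1))"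
  proof (rule nn_integral_FTC_Icc[where F = "\<lambda>u. u powr (r + 1) / (r + 1)"])
    fix u assume "u \<in> {w..a}"
    then show "((\<lambda>u. u powr (r + 1) / (r + 1)) has_real_derivative u powr r) (at u)"
      using assms False by (intro DERIV_cong[OF DERIV_cdivide[OF has_real_derivative_powr]]) auto
  qed (use assms in auto)
  with False show ?thesis by (simp add: diff_divide_distrib)
qed

lemma nn_integral_powr_atLeast:
  fixes a r :: real
  assumes "0 < a" "r < - 1"
  shows "(\<integral>\<^sup>+u. ennreal (u powr r) * indicator {a..} u \<partial>lborel) = ennreal (a powr (r + 1) / (- 1 - r))"
proof -
  have "(\<integral>\<^sup>+u. ennreal (u powr r) * indicator {a..} u \<partial>lborel) = ennreal (0 - a powr (r + 1) / (r + 1))"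
  proof (rule nn_integral_FTC_atLeast[where F = "\<lambda>u. u powr (r + 1) / (r + 1)"])
    fix u assume "a \<le> u"
    then show "((\<lambda>u. u powr (r + 1) / (r + 1)) has_real_derivative u powr r) (at u)"
      using assms by (intro DERIV_cong[OF DERIV_cdivide[OF has_real_derivative_powr]]) auto
  next
    show "((\<lambda>u. u powr (r + 1) / (r + 1)) \<longlongrightarrow> 0) at_top"
      using assms by real_asymp
  qed (use assms in auto)
  also have "0 - a powr (r + 1) / (r + 1) = a powr (r + 1) / (- 1 - r)"
    using assms by (simp add: field_simps)
  finally show ?thesis .
qed

lemma inner_tail_integral_le:
  assumes w: "0 < w" and C: "0 \<le> C" "\<And>u. w \<le> u \<Longrightarrow> tail u \<le> C * u powr (1 - \<tau>)"
  shows "(\<integral>\<^sup>+u. ennreal (real (Suc (Suc p)) * u ^ Suc p) * indicator {w..a} u * ennreal (tail u) \<partial>lborel)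
    \<le> ennreal (real (Suc (Suc p)) * C) * (\<integral>\<^sup>+u. ennreal (u powr (real p + 2 - \<tau>)) * indicator {w..a} u \<partial>lborel)"
proof -
  have "(\<integral>\<^sup>+u. ennreal (real (Suc (Suc p)) * u ^ Suc p) * indicator {w..a} u * ennreal (tail u) \<partial>lborel)
    \<le> (\<integral>\<^sup>+u. ennreal (real (Suc (Suc p)) * C) * (ennreal (u powr (real p + 2 - \<tau>)) * indicator {w..a} u) \<partial>lborel)"
  proof (rule nn_integral_mono)
    fix u :: real
    have "real (Suc (Suc p)) * u ^ Suc p * tail u \<le> real (Suc (Suc p)) * C * u powr (real p + 2 - \<tau>)" if "w \<le> u"
    proof -
      have "u ^ Suc p * u powr (1 - \<tau>) = u powr (real p + 2 - \<tau>)"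
        using w that by (simp add: powr_realpow[symmetric] powr_add[symmetric] algebra_simps del: power_Suc)
      moreover have "real (Suc (Suc p)) * u ^ Suc p * tail u \<le> real (Suc (Suc p)) * u ^ Suc p * (C * u powr (1 - \<tau>))"
        using w that by (intro mult_left_mono C) auto
      ultimately show ?thesis by (metis (no_types, lifting) mult.assoc mult.left_commute)
    qed
    then show "ennreal (real (Suc (Suc p)) * u ^ Suc p) * indicator {w..a} u * ennreal (tail u)
      \<le> ennreal (real (Suc (Suc p)) * C) * (ennreal (u powr (real p + 2 - \<tau>)) * indicator {w..a} u)"
      using w C(1) by (cases "u \<in> {w..a}")
        (auto simp: tail_def ennreal_mult'[symmetric] simp del: power_Suc of_nat_Suc intro!: ennreal_leI)
  qed
  then show ?thesis by (subst (asm) nn_integral_cmult) auto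
qed

lemma inner_tail_integral_ge:
  assumes w: "0 < w" and c: "0 \<le> c" "\<And>u. w \<le> u \<Longrightarrow> c * u powr (1 - \<tau>) \<le> tail u"
  shows "ennreal (real (Suc (Suc p)) * c) * (\<integral>\<^sup>+u. ennreal (u powr (real p + 2 - \<tau>)) * indicator {w..a} u \<partial>lborel)
    \<le> (\<integral>\<^sup>+u. ennreal (real (Suc (Suc p)) * u ^ Suc p) * indicator {w..a} u * ennreal (tail u) \<partial>lborel)"
proof -
  have "(\<integral>\<^sup>+u. ennreal (real (Suc (Suc p)) * c) * (ennreal (u powr (real p + 2 - \<tau>)) * indicator {w..a} u) \<partial>lborel)
    \<le> (\<integral>\<^sup>+u. ennreal (real (Suc (Suc p)) * u ^ Suc p) * indicator {w..a} u * ennreal (tail u) \<partial>lborel)"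
  proof (rule nn_integral_mono)
    fix u :: real
    have "real (Suc (Suc p)) * c * u powr (real p + 2 - \<tau>) \<le> real (Suc (Suc p)) * u ^ Suc p * tail u" if "w \<le> u"
    proof -
      have "u ^ Suc p * u powr (1 - \<tau>) = u powr (real p + 2 - \<tau>)"
        using w that by (simp add: powr_realpow[symmetric] powr_add[symmetric] algebra_simps del: power_Suc)
      moreover have "real (Suc (Suc p)) * u ^ Suc p * (c * u powr (1 - \<tau>)) \<le> real (Suc (Suc p)) * u ^ Suc p * tail u"
        using w that by (intro mult_left_mono c) auto
      ultimately show ?thesis by (metis (no_types, lifting) mult.assoc mult.left_commute)
    qed
    then show "ennreal (real (Suc (Suc p)) * c) * (ennreal (u powr (real p + 2 - \<tau>)) * indicator {w..a} u)
      \<le> ennreal (real (Suc (Suc p)) * u ^ Suc p) * indicator {w..a} u * ennreal (tail u)"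
      using w c(1) by (cases "u \<in> {w..a}")
        (auto simp: tail_def ennreal_mult'[symmetric] simp del: power_Suc of_nat_Suc intro!: ennreal_leI)
  qed
  then show ?thesis by (subst (asm) nn_integral_cmult) auto
qed

text \<open>The integrand is at most a multiple of \<open>u powr (2 - \<tau>)\<close>, integrable at
  infinity because \<open>\<tau> > 3\<close>.\<close>

lemma outer_tail_integral_le:
  assumes a: "0 < a" and C: "0 \<le> C" "\<And>u. a \<le> u \<Longrightarrow> tail u \<le> C * u powr (1 - \<tau>)" and \<tau>: "3 < \<tau>"
  shows "(\<integral>\<^sup>+u. ennreal (2 * u) * indicator {a..} u * ennreal (tail u) \<partial>lborel)
    \<le> ennreal (2 * C * (a powr (3 - \<tau>) / (\<tau> - 3)))"
proof -
  have "(\<integral>\<^sup>+u. ennreal (2 * u) * indicator {a..} u * ennreal (tail u) \<partial>lborel)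
    \<le> (\<integral>\<^sup>+u. ennreal (2 * C) * (ennreal (u powr (2 - \<tau>)) * indicator {a..} u) \<partial>lborel)"
  proof (rule nn_integral_mono)
    fix u :: real
    have "2 * u * tail u \<le> 2 * C * u powr (2 - \<tau>)" if "a \<le> u"
    proof -
      have "u * u powr (1 - \<tau>) = u powr (2 - \<tau>)"
        using a that by (simp add: powr_mult_base)
      moreover have "2 * u * tail u \<le> 2 * u * (C * u powr (1 - \<tau>))"
        using a that by (intro mult_left_mono C) auto
      ultimately show ?thesis by (metis (no_types, lifting) mult.assoc mult.left_commute)
    qed
    then show "ennreal (2 * u) * indicator {a..} u * ennreal (tail u)
      \<le> ennreal (2 * C) * (ennreal (u powr (2 - \<tau>)) * indicator {a..} u)"
      using a C(1) by (cases "u \<in> {a..}")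
        (auto simp: tail_def ennreal_mult'[symmetric] intro!: ennreal_leI)
  qed
  also have "\<dots> = ennreal (2 * C) * ennreal (a powr (2 - \<tau> + 1) / (- 1 - (2 - \<tau>)))"
    using nn_integral_powr_atLeast[OF a, of "2 - \<tau>"] \<tau> by (subst nn_integral_cmult) auto
  also have "\<dots> = ennreal (2 * C * (a powr (3 - \<tau>) / (\<tau> - 3)))"
    using C(1) by (subst ennreal_mult'[symmetric]) (simp_all add: algebra_simps)
  finally show ?thesis .
qed

text \<open>The part shared by both power-law cases. \<open>J\<close> leaves open whether the
  integral over \<open>{w..1 / m}\<close> yields a power or a logarithm.\<close>

lemma truncated_moment_upper:
  assumes m: "0 < m" "w \<le> 1 / m" and w: "0 < w" and \<tau>: "3 < \<tau>"
    and C: "0 \<le> C" "\<And>u. w \<le> u \<Longrightarrow> tail u \<le> C * u powr (1 - \<tau>)"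
    and J: "0 \<le> J" "(\<integral>\<^sup>+u. ennreal (u powr (real p + 2 - \<tau>)) * indicator {w..1 / m} u \<partial>lborel) \<le> ennreal J"
  shows "truncated_moment p m
    \<le> m ^ p * w ^ Suc (Suc p) + (m ^ p * (real (Suc (Suc p)) * C * J) + 2 * C * ((1 / m) powr (3 - \<tau>) / (\<tau> - 3)))"
proof -
  have "ennreal (truncated_moment p m) \<le> ennreal (m ^ p * w ^ Suc (Suc p))
    + (ennreal (m ^ p) * (ennreal (real (Suc (Suc p)) * C) * ennreal J) + ennreal (2 * C * ((1 / m) powr (3 - \<tau>) / (\<tau> - 3))))"
  proof (intro order_trans[OF truncated_moment_le[OF m(1) _ m(2)]] add_mono mult_left_mono)
    show "(\<integral>\<^sup>+u. ennreal (real (Suc (Suc p)) * u ^ Suc p) * indicator {w..1 / m} u * ennreal (tail u) \<partial>lborel)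
        \<le> ennreal (real (Suc (Suc p)) * C) * ennreal J"
      by (rule order_trans[OF inner_tail_integral_le mult_left_mono]) (use w C J in auto)
    show "(\<integral>\<^sup>+u. ennreal (2 * u) * indicator {1 / m..} u * ennreal (tail u) \<partial>lborel)
        \<le> ennreal (2 * C * ((1 / m) powr (3 - \<tau>) / (\<tau> - 3)))"
      using m C \<tau> by (intro outer_tail_integral_le) auto
  qed (use w in auto)
  also have "\<dots> = ennreal (m ^ p * w ^ Suc (Suc p) + (m ^ p * (real (Suc (Suc p)) * C * J)
      + 2 * C * ((1 / m) powr (3 - \<tau>) / (\<tau> - 3))))"
    using m w C J \<tau> by (simp add: ennreal_mult'[symmetric] ennreal_plus[symmetric] del: ennreal_plus power_Suc of_nat_Suc)
  finally show ?thesis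
    using m w C J \<tau> by (subst (asm) ennreal_le_iff) (auto intro!: add_nonneg_nonneg simp del: power_Suc of_nat_Suc)
qed

text \<open>The exponent \<open>p + 2 - \<tau>\<close> exceeds \<open>- 1\<close>, so the inner
  integral is governed by its upper end \<open>1 / m\<close>. It then has the order of the outer
  one, and the weights below \<open>w\<close> contribute the smaller order \<open>m ^ p\<close>. The
  lower bound needs only the tail at \<open>1 / m\<close>.\<close>

lemma truncated_moment_power_law_case:
  assumes pl: "power_law M W \<tau>" and \<tau>: "3 < \<tau>" "\<tau> < real p + 3"
  shows "truncated_moment p \<in> \<Theta>[at_right 0](\<lambda>m. m powr (\<tau> - 3))"
proof -
  obtain c C w where t: "0 < c" "0 < C" "1 < w"
    "\<And>u. w \<le> u \<Longrightarrow> c * u powr (1 - \<tau>) \<le> tail u"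
    "\<And>u. w \<le> u \<Longrightarrow> tail u \<le> C * u powr (1 - \<tau>)"
    using power_law_tail[OF pl] by blast
  let ?r = "real p + 2 - \<tau>"
  \<comment> \<open>The contributions of the weights below \<open>w\<close>, between
    \<open>w\<close> and \<open>1 / m\<close>, and above \<open>1 / m\<close>.\<close>
  let ?D = "w ^ Suc (Suc p) + (real (Suc (Suc p)) * C / (?r + 1) + 2 * C / (\<tau> - 3))"
  have "0 < w ^ Suc (Suc p)" using t by simp
  then have D: "0 < ?D" using t \<tau> by (intro add_pos_nonneg add_nonneg_nonneg) auto
  have "\<forall>\<^sub>F m in at_right (0::real). 0 < m \<and> m < 1 / w"
    using eventually_at_right_real[of 0 "1 / w"] t by simp
  then have "\<forall>\<^sub>F m in at_right 0. c * norm (m powr (\<tau> - 3)) \<le> norm (truncated_moment p m) \<and>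
      norm (truncated_moment p m) \<le> ?D * norm (m powr (\<tau> - 3))"
  proof eventually_elim
    case (elim m)
    then have m: "0 < m" "w \<le> 1 / m" using t by (auto simp: field_simps)
    have m1: "m \<le> 1" using elim t(3) by (smt (verit) divide_le_eq_1_pos)
    have inv: "(1 / m) powr s = m powr (- s)" for s using m by (simp add: powr_minus_divide powr_divide)
    have "(1 / m) ^ 2 * (c * (1 / m) powr (1 - \<tau>)) \<le> truncated_moment p m"
      using t(4)[OF m(2)] by (intro order_trans[OF _ truncated_moment_tail_le[OF m(1)]] mult_left_mono) auto
    moreover have "(1 / m) ^ 2 * (c * (1 / m) powr (1 - \<tau>)) = c * m powr (\<tau> - 3)"
    proof -
      have "(1 / m) ^ 2 = (1 / m) powr 2" using m by (simp add: powr_numeral)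
      then have "(1 / m) ^ 2 * (1 / m) powr (1 - \<tau>) = (1 / m) powr (2 + (1 - \<tau>))" by (simp only: powr_add)
      then show ?thesis by (simp add: inv algebra_simps)
    qed
    ultimately have lower: "c * m powr (\<tau> - 3) \<le> truncated_moment p m" by simp
    let ?J = "(1 / m) powr (?r + 1) / (?r + 1)"
    have "truncated_moment p m
      \<le> m ^ p * w ^ Suc (Suc p) + (m ^ p * (real (Suc (Suc p)) * C * ?J) + 2 * C * ((1 / m) powr (3 - \<tau>) / (\<tau> - 3)))"
    proof (rule truncated_moment_upper[OF m _ \<tau>(1) _ t(5)])
      show "(\<integral>\<^sup>+u. ennreal (u powr ?r) * indicator {w..1 / m} u \<partial>lborel) \<le> ennreal ?J"
        using t m \<tau> by (subst nn_integral_powr_Icc) (auto intro!: ennreal_leI divide_right_mono)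
    qed (use t m \<tau> in auto)
    also have "m ^ p * (real (Suc (Suc p)) * C * ?J) = real (Suc (Suc p)) * C / (?r + 1) * m powr (\<tau> - 3)"
    proof -
      have "m ^ p * (1 / m) powr (?r + 1) = m powr (\<tau> - 3)"
        using m by (simp add: inv powr_realpow[symmetric] powr_add[symmetric] algebra_simps)
      then show ?thesis by (simp add: field_simps del: of_nat_Suc)
    qed
    also have "(1 / m) powr (3 - \<tau>) = m powr (\<tau> - 3)" by (simp add: inv)
    also have "m ^ p * w ^ Suc (Suc p) \<le> m powr (\<tau> - 3) * w ^ Suc (Suc p)"
    proof (rule mult_right_mono)
      show "m ^ p \<le> m powr (\<tau> - 3)"
        using m m1 \<tau> by (simp add: powr_realpow[symmetric] powr_mono')
    qed (use t in auto)
    finally have "truncated_moment p m \<le> ?D * m powr (\<tau> - 3)" by (simp add: algebra_simps)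
    with lower show ?case using truncated_moment_pos[OF m(1), of p] by simp
  qed
  then show ?thesis by (rule bigthetaI'[OF t(1) D])
qed

text \<open>All scales between \<open>w\<close> and \<open>1 / m\<close> contribute equally, which
  produces \<open>ln (1 / m)\<close>. The other two contributions are of order \<open>m ^ p\<close>
  and are absorbed by the logarithm; the lower bound has to come from the intermediate scales
  too.\<close>

lemma truncated_moment_critical_case:
  assumes pl: "power_law M W (real p + 3)" and p: "0 < p"
  shows "truncated_moment p \<in> \<Theta>[at_right 0](\<lambda>m. m powr real p * ln (1 / m))"
proof -
  obtain c C w where t: "0 < c" "0 < C" "1 < w"
    "\<And>u. w \<le> u \<Longrightarrow> c * u powr (1 - (real p + 3)) \<le> tail u"
    "\<And>u. w \<le> u \<Longrightarrow> tail u \<le> C * u powr (1 - (real p + 3))"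
    using power_law_tail[OF pl] by blast
  define K where "K = real (Suc (Suc p))"
  have K: "0 < K" by (simp add: K_def)
  let ?D = "1 + K * C"
  have "\<forall>\<^sub>F m in at_right (0::real). 0 < m \<and> m < 1 / w"
    using eventually_at_right_real[of 0 "1 / w"] t by simp
  \<comment> \<open>The first condition absorbs the two terms without logarithm into
    \<open>L\<close>, the second one makes \<open>L - ln w\<close> at least
    \<open>L / 2\<close>.\<close>
  moreover have "\<forall>\<^sub>F m in at_right (0::real). w ^ Suc (Suc p) + 2 * C / real p \<le> ln (1 / m)"
    by real_asymp
  moreover have "\<forall>\<^sub>F m in at_right (0::real). ln w \<le> ln (1 / m) / 2"
    by real_asymp
  ultimately have "\<forall>\<^sub>F m in at_right 0. K * c / 2 * norm (m powr real p * ln (1 / m)) \<le> norm (truncated_moment p m) \<and>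
      norm (truncated_moment p m) \<le> ?D * norm (m powr real p * ln (1 / m))"
  proof eventually_elim
    case (elim m)
    then have m: "0 < m" "w \<le> 1 / m" using t by (auto simp: field_simps)
    define L where "L = ln (1 / m)"
    have L: "w ^ Suc (Suc p) + 2 * C / real p \<le> L" "ln w \<le> L / 2" using elim by (simp_all add: L_def)
    have "0 < ln w" using t by simp
    with L have Lpos: "0 < L" by linarith
    have int: "(\<integral>\<^sup>+u. ennreal (u powr (real p + 2 - (real p + 3))) * indicator {w..1 / m} u \<partial>lborel) = ennreal (L - ln w)"
      using nn_integral_powr_Icc[of w "1 / m" "- 1"] t m by (simp add: L_def)
    have "ennreal (m ^ p * (K * c * (L - ln w))) = ennreal (m ^ p) * (ennreal (K * c) * ennreal (L - ln w))"
      using m t K L Lpos by (simp add: ennreal_mult'[symmetric])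
    also have "\<dots> \<le> ennreal (truncated_moment p m)"
      unfolding int[symmetric] K_def
      using t by (intro order_trans[OF mult_left_mono[OF inner_tail_integral_ge] truncated_moment_ge] m) auto
    finally have "m ^ p * (K * c * (L - ln w)) \<le> truncated_moment p m"
      using truncated_moment_pos[OF m(1), of p] by (subst (asm) ennreal_le_iff) auto
    moreover have "m ^ p * (K * c * (L / 2)) \<le> m ^ p * (K * c * (L - ln w))"
      using L m K t by (intro mult_left_mono) auto
    ultimately have lower: "K * c / 2 * (m ^ p * L) \<le> truncated_moment p m" by (simp add: algebra_simps)
    have "truncated_moment p m \<le> m ^ p * w ^ Suc (Suc p) + (m ^ p * (K * C * L)
        + 2 * C * ((1 / m) powr (3 - (real p + 3)) / (real p + 3 - 3)))"
      unfolding K_def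
    proof (rule truncated_moment_upper[OF m _ _ _ t(5)])
      show "(\<integral>\<^sup>+u. ennreal (u powr (real p + 2 - (real p + 3))) * indicator {w..1 / m} u \<partial>lborel) \<le> ennreal L"
        unfolding int using \<open>0 < ln w\<close> by (intro ennreal_leI) simp
    qed (use t m p Lpos in auto)
    also have "(1 / m) powr (3 - (real p + 3)) = m ^ p"
      using m by (simp add: powr_minus_divide powr_divide powr_realpow)
    also have "m ^ p * w ^ Suc (Suc p) + (m ^ p * (K * C * L) + 2 * C * (m ^ p / (real p + 3 - 3)))
        = m ^ p * (w ^ Suc (Suc p) + 2 * C / real p + K * C * L)"
      by (simp add: algebra_simps)
    also have "\<dots> \<le> m ^ p * (L + K * C * L)" using L m by (intro mult_left_mono) auto
    finally have "truncated_moment p m \<le> ?D * (m ^ p * L)" by (simp add: algebra_simps)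
    with lower show ?case
      using truncated_moment_pos[OF m(1), of p] m Lpos by (simp add: powr_realpow L_def[symmetric])
  qed
  then show ?thesis by (rule bigthetaI'[rotated 2]) (use K t in \<open>auto intro: add_pos_pos\<close>)
qed

end

section \<open>Inversion of asymptotic relations\<close>

lemma powr_inversion:
  fixes m X :: "'a \<Rightarrow> real" and p :: real
  assumes p: "0 < p"
    and pos: "\<forall>\<^sub>F x in F. 0 < m x" "\<forall>\<^sub>F x in F. 0 < X x"
    and X: "X \<in> \<Theta>[F](\<lambda>x. m x powr p)"
  shows "m \<in> \<Theta>[F](\<lambda>x. X x powr (1 / p))"
proof -
  \<comment> \<open>The absolute values are there to match the form of \<open>bigtheta_powr\<close>;
    positivity removes them again.\<close>
  have "m \<in> \<Theta>[F](\<lambda>x. \<bar>m x powr p\<bar> powr (1 / p))"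
    by (rule bigthetaI_cong, use pos(1) in eventually_elim) (use p in \<open>simp add: powr_powr\<close>)
  also have "(\<lambda>x. \<bar>m x powr p\<bar> powr (1 / p)) \<in> \<Theta>[F](\<lambda>x. \<bar>X x\<bar> powr (1 / p))"
    by (rule bigtheta_powr) (use X in \<open>simp add: bigtheta_sym\<close>)
  also have "(\<lambda>x. \<bar>X x\<bar> powr (1 / p)) \<in> \<Theta>[F](\<lambda>x. X x powr (1 / p))"
    by (rule bigthetaI_cong, use pos(2) in eventually_elim) simp
  finally show ?thesis .
qed

text \<open>Taking logarithms in \<open>X \<asymp> m powr p * ln (1 / m)\<close> gives \<open>ln (1 / X) \<asymp> ln (1 / m)\<close>.\<close>

lemma powr_log_inversion:
  fixes m X :: "'a \<Rightarrow> real" and p :: real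
  assumes p: "0 < p"
    and m: "filterlim m (at_right 0) F"
    and pos: "\<forall>\<^sub>F x in F. 0 < X x"
    and X: "X \<in> \<Theta>[F](\<lambda>x. m x powr p * ln (1 / m x))"
  shows "m \<in> \<Theta>[F](\<lambda>x. (X x / ln (1 / X x)) powr (1 / p))"
proof -
  obtain c where c: "0 < c" "\<forall>\<^sub>F x in F. norm (X x) \<le> c * norm (m x powr p * ln (1 / m x))"
    using X by (auto simp: bigtheta_def elim: landau_o.bigE)
  obtain d where d: "0 < d" "\<forall>\<^sub>F x in F. norm (X x) \<ge> d * norm (m x powr p * ln (1 / m x))"
    using X by (auto simp: bigtheta_def elim: landau_omega.bigE)
  have "\<forall>\<^sub>F y in at_right (0::real). 0 < y \<and> y < 1"
    by (auto simp: eventually_at_right_less intro!: eventually_conj eventually_at_right_real[of 0 1, THEN eventually_mono])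
  \<comment> \<open>Only the order of \<open>ln (1 / X)\<close> is wanted, so crude powers suffice:
    the exponents \<open>p / 2\<close> and \<open>p + 1\<close> lie on either side of
    \<open>p\<close> and become the constants in the comparison of logarithms.\<close>
  moreover have "\<forall>\<^sub>F y in at_right (0::real). c * (y powr p * ln (1 / y)) \<le> y powr (p / 2)"
    using p c(1) by real_asymp
  moreover have "\<forall>\<^sub>F y in at_right (0::real). y powr (p + 1) \<le> d * (y powr p * ln (1 / y))"
    using p d(1) by real_asymp
  ultimately have "\<forall>\<^sub>F y in at_right (0::real). 0 < y \<and> y < 1 \<and>
      c * (y powr p * ln (1 / y)) \<le> y powr (p / 2) \<and> y powr (p + 1) \<le> d * (y powr p * ln (1 / y))"
    by (intro eventually_conj) (auto elim: eventually_mono)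
  with m have ev: "\<forall>\<^sub>F x in F. 0 < m x \<and> m x < 1 \<and> c * (m x powr p * ln (1 / m x)) \<le> m x powr (p / 2)
      \<and> m x powr (p + 1) \<le> d * (m x powr p * ln (1 / m x))"
    by (auto simp: filterlim_iff)
  have bnd: "\<forall>\<^sub>F x in F. 0 < m x \<and> 0 < ln (1 / m x) \<and> 0 < ln (1 / X x) \<and> p / 2 * ln (1 / m x) \<le> ln (1 / X x) \<and> ln (1 / X x) \<le> (p + 1) * ln (1 / m x)"
    using ev c(2) d(2) pos
  proof eventually_elim
    case (elim x)
    then have "0 < ln (1 / m x)" by simp
    with elim have "X x \<le> m x powr (p / 2)" "m x powr (p + 1) \<le> X x" by auto
    then have "ln (X x) \<le> ln (m x powr (p / 2))" "ln (m x powr (p + 1)) \<le> ln (X x)"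
      using elim by (simp_all del: ln_powr)
    then have "ln (X x) \<le> p / 2 * ln (m x)" "(p + 1) * ln (m x) \<le> ln (X x)"
      by (simp_all only: ln_powr)
    then have *: "p / 2 * ln (1 / m x) \<le> ln (1 / X x) \<and> ln (1 / X x) \<le> (p + 1) * ln (1 / m x)"
      using elim by (simp add: ln_div algebra_simps)
    have "0 < p / 2 * ln (1 / m x)" using \<open>0 < ln (1 / m x)\<close> p by simp
    with * have "0 < ln (1 / X x)" by linarith
    with \<open>0 < ln (1 / m x)\<close> * elim show ?case by blast
  qed
  have "(\<lambda>x. ln (1 / X x)) \<in> \<Theta>[F](\<lambda>x. ln (1 / m x))"
  proof (rule bigthetaI'[of "p / 2" "p + 1"])
    show "\<forall>\<^sub>F x in F. p / 2 * norm (ln (1 / m x)) \<le> norm (ln (1 / X x)) \<and>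
        norm (ln (1 / X x)) \<le> (p + 1) * norm (ln (1 / m x))"
      using bnd by eventually_elim (simp only: real_norm_def abs_of_pos simp_thms)
  qed (use p in auto)
  then have "(\<lambda>x. X x / ln (1 / X x)) \<in> \<Theta>[F](\<lambda>x. m x powr p * ln (1 / m x) / ln (1 / m x))"
    using X bnd by (intro landau_theta.divide) (auto simp: bigtheta_sym elim!: eventually_mono)
  also have "(\<lambda>x. m x powr p * ln (1 / m x) / ln (1 / m x)) \<in> \<Theta>[F](\<lambda>x. m x powr p)"
    by (rule bigthetaI_cong) (use bnd in \<open>auto elim!: eventually_mono\<close>)
  finally have *: "(\<lambda>x. X x / ln (1 / X x)) \<in> \<Theta>[F](\<lambda>x. m x powr p)" .
  show ?thesis
  proof (rule powr_inversion[OF p _ _ *])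
    show "\<forall>\<^sub>F x in F. 0 < m x" using bnd by (auto elim: eventually_mono)
    show "\<forall>\<^sub>F x in F. 0 < X x / ln (1 / X x)"
      using bnd pos by eventually_elim simp
  qed
qed

text \<open>Makes the critical exponents unique. The substitution of the inverse of
  \<open>x - a\<close> moves the limit to infinity, where powers are compared by
  \<open>powr_bigtheta_iff\<close>.\<close>

lemma powr_bigtheta_at_right_unique:
  fixes a :: real
  assumes "f \<in> \<Theta>[at_right a](\<lambda>x. (x - a) powr p)" "f \<in> \<Theta>[at_right a](\<lambda>x. (x - a) powr q)"
  shows "p = q"
proof -
  have lim: "filterlim (\<lambda>x. inverse (x - a)) at_top (at_right a)"
    by real_asymp
  have "(\<lambda>x. (x - a) powr p) \<in> \<Theta>[at_right a](\<lambda>x. (x - a) powr q)"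
    using assms landau_theta.trans bigtheta_sym by blast
  moreover have "(x - a) powr r = inverse (x - a) powr (- r)" if "a < x" for x r
    using that by (simp add: powr_minus inverse_powr)
  then have eq: "\<forall>\<^sub>F x in at_right a. (x - a) powr r = inverse (x - a) powr (- r)" for r
    by (auto simp: eventually_at_filter)
  ultimately have "(\<lambda>x. inverse (x - a) powr (- p)) \<in> \<Theta>[at_right a](\<lambda>x. inverse (x - a) powr (- q))"
    using landau_theta.in_cong[OF eq] landau_theta.cong[OF eq] by blast
  with powr_bigtheta_iff[OF lim, of "- p" "- q"] show ?thesis by simp
qed

section \<open>The mean-field equation\<close>

text \<open>If \<open>m x \<ge> e\<close>, then
  \<open>Y x \<ge> \<rho> (m x) \<ge> \<rho> e > 0\<close>, which is eventually impossible. This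
  sends the solutions to \<open>0\<close> without any continuity of theirs.\<close>

lemma mono_bound_filterlim_at_right_0:
  fixes \<rho> :: "real \<Rightarrow> real"
  assumes mono: "\<And>s t. 0 < s \<Longrightarrow> s \<le> t \<Longrightarrow> \<rho> s \<le> \<rho> t" and pos: "\<And>t. 0 < t \<Longrightarrow> 0 < \<rho> t"
    and m: "\<forall>\<^sub>F x in F. 0 < m x" and le: "\<forall>\<^sub>F x in F. \<rho> (m x) \<le> Y x" and Y: "(Y \<longlongrightarrow> 0) F"
  shows "filterlim m (at_right 0) F"
proof -
  have "(m \<longlongrightarrow> 0) F"
  proof (rule order_tendstoI)
    fix e :: real assume "0 < e"
    from order_tendstoD(2)[OF Y pos[OF this]] m le show "\<forall>\<^sub>F x in F. m x < e"
    proof eventually_elim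
      case (elim x)
      show ?case
      proof (rule ccontr)
        assume "\<not> m x < e"
        with mono[of e "m x"] \<open>0 < e\<close> elim show False by simp
      qed
    qed
  qed (use m in \<open>auto elim: eventually_mono\<close>)
  with m show ?thesis by (auto simp: filterlim_at elim: eventually_mono)
qed

lemma tendsto_0_bigtheta:
  fixes f f' :: "'a \<Rightarrow> real"
  assumes "f \<in> \<Theta>[F](f')" "(f' \<longlongrightarrow> 0) F"
  shows "(f \<longlongrightarrow> 0) F"
proof -
  have "f' \<in> o[F](\<lambda>_. 1)" by (rule smalloI_tendsto) (use assms(2) in auto)
  with assms(1) have "f \<in> o[F](\<lambda>_. 1)"
    by (subst landau_o.small.in_cong_bigtheta)
  from smalloD_tendsto[OF this] show ?thesis by simp
qed

locale mean_field = weight M W + response \<kappa> k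
  for M :: "'w measure" and W \<kappa> k +
  fixes B :: real
  assumes kappa1_le: "\<And>t. 0 \<le> t \<Longrightarrow> \<kappa> 1 t \<le> B"
begin

abbreviation "p \<equiv> k - 2"
abbreviation "EW \<equiv> \<integral>\<omega>. W \<omega> \<partial>M"

definition phi :: "real \<Rightarrow> real \<Rightarrow> real" where "phi h m = size_biased M W (\<lambda>w. \<kappa> 1 (w * m + h))"
definition crit :: real where "crit = 1 / (size_biased M W (\<lambda>w. w) * \<kappa> 2 0)"
text \<open>The left-hand side of both equations in the overview, multiplied by \<open>EW\<close>: a
  plain expectation in place of the size-biased one.\<close>

definition gap :: "real \<Rightarrow> real \<Rightarrow> real" where "gap h m = (\<integral>\<omega>. W \<omega> * rem (W \<omega> * m + h) \<partial>M)"

lemma kappa1_measurable [measurable]: "\<kappa> 1 \<in> borel_measurable borel"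
  by (intro borel_measurable_continuous_onI continuous_at_imp_continuous_on) (blast intro: DERIV_isCont kappa_deriv)

lemma rem_measurable [measurable]: "rem \<in> borel_measurable borel"
  by (intro borel_measurable_continuous_onI rem_continuous)

lemma W2_pos: "0 < (\<integral>\<omega>. W \<omega> ^ 2 \<partial>M)"
  by (intro expectation_pos W2_integrable zero_less_power W_pos)

lemma crit_pos: "0 < crit"
  using W2_pos mean_pos kappa2_pos by (simp add: crit_def size_biased_def power2_eq_square)

lemma inverse_crit: "1 / crit = (\<integral>\<omega>. W \<omega> ^ 2 \<partial>M) / EW * \<kappa> 2 0"
  by (simp add: crit_def size_biased_def power2_eq_square)

lemma gap_integrable:
  assumes "0 \<le> m" "0 \<le> h" shows "integrable M (\<lambda>\<omega>. W \<omega> * rem (W \<omega> * m + h))"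
proof (rule Bochner_Integration.integrable_bound)
  show "integrable M (\<lambda>\<omega>. \<kappa> 2 0 * (m * W \<omega> ^ 2 + h * W \<omega>))"
    using W2_integrable integrable_W by simp
  show "AE \<omega> in M. norm (W \<omega> * rem (W \<omega> * m + h)) \<le> norm (\<kappa> 2 0 * (m * W \<omega> ^ 2 + h * W \<omega>))"
  proof (rule AE_I2)
    fix \<omega> assume "\<omega> \<in> space M"
    then have W: "0 < W \<omega>" by (rule W_pos)
    then have t: "0 \<le> W \<omega> * m + h" using assms by simp
    have "W \<omega> * rem (W \<omega> * m + h) \<le> W \<omega> * (\<kappa> 2 0 * (W \<omega> * m + h))"
      using W t by (intro mult_left_mono rem_le) auto
    also have "\<dots> = \<kappa> 2 0 * (m * W \<omega> ^ 2 + h * W \<omega>)" by (simp add: algebra_simps power2_eq_square)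
    finally show "norm (W \<omega> * rem (W \<omega> * m + h)) \<le> norm (\<kappa> 2 0 * (m * W \<omega> ^ 2 + h * W \<omega>))"
      using W rem_nonneg[OF t] kappa2_pos assms by (simp add: abs_mult)
  qed
qed simp

text \<open>Substitute \<open>\<kappa> 1 t = \<kappa> 2 0 * t - rem t\<close> at
  \<open>t = W \<omega> * m + h\<close>; the part linear in \<open>m\<close> has slope
  \<open>1 / crit\<close> by the choice of \<open>crit\<close>.\<close>

lemma phi_eq:
  assumes "0 \<le> m" "0 \<le> h" shows "phi h m = m / crit + \<kappa> 2 0 * h - gap h m / EW"
proof -
  have "(\<integral>\<omega>. W \<omega> * \<kappa> 1 (W \<omega> * m + h) \<partial>M)
      = (\<integral>\<omega>. (\<kappa> 2 0 * m) * W \<omega> ^ 2 + (\<kappa> 2 0 * h) * W \<omega> - W \<omega> * rem (W \<omega> * m + h) \<partial>M)"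
    by (intro Bochner_Integration.integral_cong) (auto simp: rem_def algebra_simps power2_eq_square)
  also have "\<dots> = \<kappa> 2 0 * m * (\<integral>\<omega>. W \<omega> ^ 2 \<partial>M) + \<kappa> 2 0 * h * EW - gap h m"
    using gap_integrable[OF assms] W2_integrable integrable_W by (simp add: gap_def)
  finally have "phi h m = (\<kappa> 2 0 * m * (\<integral>\<omega>. W \<omega> ^ 2 \<partial>M) + \<kappa> 2 0 * h * EW - gap h m) / EW"
    by (simp add: phi_def size_biased_def)
  also have "\<dots> = m * ((\<integral>\<omega>. W \<omega> ^ 2 \<partial>M) / EW * \<kappa> 2 0) + \<kappa> 2 0 * h - gap h m / EW"
    using mean_pos by (simp add: field_simps)
  finally show ?thesis unfolding inverse_crit[symmetric] by simp
qed

lemma phi_bounds: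
  assumes "0 \<le> m" "0 \<le> h" shows "0 \<le> phi h m" "phi h m \<le> B"
proof -
  have t: "0 \<le> W \<omega> * m + h" if "\<omega> \<in> space M" for \<omega> using W_pos[OF that] assms by simp
  have "0 \<le> (\<integral>\<omega>. W \<omega> * \<kappa> 1 (W \<omega> * m + h) \<partial>M)"
    using t kappa1_nonneg W_pos by (intro integral_nonneg_AE AE_I2 mult_nonneg_nonneg) (auto simp: less_imp_le)
  then show "0 \<le> phi h m" using mean_pos by (simp add: phi_def size_biased_def)
  have "(\<integral>\<omega>. W \<omega> * \<kappa> 1 (W \<omega> * m + h) \<partial>M) \<le> (\<integral>\<omega>. W \<omega> * B \<partial>M)"
  proof (rule integral_mono')
    fix \<omega> assume "\<omega> \<in> space M"
    with t kappa1_le W_pos show "W \<omega> * \<kappa> 1 (W \<omega> * m + h) \<le> W \<omega> * B" by (intro mult_left_mono) (auto simp: less_imp_le)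
    \<comment> \<open>\<open>integral_mono'\<close> asks for integrability of the dominating
      function only, and for its nonnegativity in return. The sign of \<open>B\<close> follows from
      \<open>0 \<le> \<kappa> 1 \<le> B\<close>.\<close>
    from \<open>\<omega> \<in> space M\<close> t kappa1_le kappa1_nonneg W_pos show "0 \<le> W \<omega> * B"
      by (intro mult_nonneg_nonneg) (auto simp: less_imp_le intro: order_trans)
  qed (use integrable_W in simp)
  then show "phi h m \<le> B" using mean_pos by (simp add: phi_def size_biased_def field_simps)
qed

lemma phi_continuous:
  assumes "0 \<le> h" shows "continuous_on {0..} (phi h)"
  unfolding continuous_on_sequentially
proof (intro allI ballI impI, elim conjE)
  fix x and a :: real assume a: "a \<in> {0..}" and x: "\<forall>n. x n \<in> {0..}" "x \<longlonglongrightarrow> a"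
  have "(\<lambda>n. \<integral>\<omega>. W \<omega> * \<kappa> 1 (W \<omega> * x n + h) \<partial>M) \<longlonglongrightarrow> (\<integral>\<omega>. W \<omega> * \<kappa> 1 (W \<omega> * a + h) \<partial>M)"
  proof (rule integral_dominated_convergence[where w = "\<lambda>\<omega>. W \<omega> * B"])
    have "isCont (\<kappa> 1) t" for t by (rule DERIV_isCont[OF kappa_deriv])
    then show "AE \<omega> in M. (\<lambda>n. W \<omega> * \<kappa> 1 (W \<omega> * x n + h)) \<longlonglongrightarrow> W \<omega> * \<kappa> 1 (W \<omega> * a + h)"
      by (intro AE_I2 tendsto_intros isCont_tendsto_compose[of _ "\<kappa> 1"] x)
    show "AE \<omega> in M. norm (W \<omega> * \<kappa> 1 (W \<omega> * x n + h)) \<le> W \<omega> * B" for n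
    proof (rule AE_I2)
      fix \<omega> assume "\<omega> \<in> space M"
      then have W: "0 < W \<omega>" by (rule W_pos)
      then have "0 \<le> W \<omega> * x n + h" using x(1) assms by simp
      from kappa1_nonneg[OF this] kappa1_le[OF this] W
      show "norm (W \<omega> * \<kappa> 1 (W \<omega> * x n + h)) \<le> W \<omega> * B" by (simp add: abs_mult)
    qed
  next
    show "(\<lambda>\<omega>. W \<omega> * \<kappa> 1 (W \<omega> * a + h)) \<in> borel_measurable M" by measurable
    show "(\<lambda>\<omega>. W \<omega> * \<kappa> 1 (W \<omega> * x n + h)) \<in> borel_measurable M" for n by measurable
  qed (use integrable_W in simp)
  then show "(phi h \<circ> x) \<longlonglongrightarrow> phi h a"
    using mean_pos unfolding phi_def size_biased_def o_def by (intro tendsto_intros) auto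
qed

text \<open>The intermediate value theorem. The free left end \<open>a\<close> serves to stay away
  from the trivial solution.\<close>

lemma phi_fixpoint_exists:
  assumes "0 < \<theta>" "0 \<le> h" "0 \<le> a" "a / \<theta> \<le> phi h a"
  obtains m where "a \<le> m" "m / \<theta> = phi h m"
proof -
  \<comment> \<open>At \<open>b\<close> the line is above the map, since
    \<open>phi h b \<le> B \<le> b / \<theta>\<close>.\<close>
  define b where "b = max a (B * \<theta>)"
  have "phi h b - b / \<theta> \<le> B - b / \<theta>" using phi_bounds(2)[of b h] assms by (simp add: b_def)
  also have "\<dots> \<le> 0" using assms by (simp add: b_def field_simps)
  finally have "phi h b - b / \<theta> \<le> 0" .
  moreover have "continuous_on {a..b} (\<lambda>m. phi h m - m / \<theta>)"
    using assms by (intro continuous_intros continuous_on_subset[OF phi_continuous]) auto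
  ultimately obtain m where "a \<le> m" "phi h m - m / \<theta> = 0"
    using IVT2'[of "\<lambda>m. phi h m - m / \<theta>" b 0 a] assms by (auto simp: b_def)
  with that show thesis by simp
qed

lemma gap_strict_mono:
  assumes "0 \<le> h" "0 \<le> s" "s < t" shows "gap h s < gap h t"
proof -
  have "0 < (\<integral>\<omega>. W \<omega> * rem (W \<omega> * t + h) - W \<omega> * rem (W \<omega> * s + h) \<partial>M)"
  proof (rule expectation_pos)
    fix \<omega> assume "\<omega> \<in> space M"
    then have W: "0 < W \<omega>" by (rule W_pos)
    then have "rem (W \<omega> * s + h) < rem (W \<omega> * t + h)" using assms by (intro rem_strict_mono) auto
    with W show "0 < W \<omega> * rem (W \<omega> * t + h) - W \<omega> * rem (W \<omega> * s + h)" by simp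
  qed (use assms gap_integrable in auto)
  also have "\<dots> = gap h t - gap h s"
    unfolding gap_def by (rule Bochner_Integration.integral_diff) (use assms gap_integrable in auto)
  finally show ?thesis by simp
qed

lemma gap_slope_strict_mono:
  assumes "0 < s" "s < t" shows "gap 0 s / s < gap 0 t / t"
proof -
  have int: "integrable M (\<lambda>\<omega>. W \<omega> * rem (W \<omega> * m + 0) / m)" if "0 < m" for m
    using gap_integrable[of m 0] that by simp
  have "0 < (\<integral>\<omega>. W \<omega> * rem (W \<omega> * t + 0) / t - W \<omega> * rem (W \<omega> * s + 0) / s \<partial>M)"
  proof (rule expectation_pos)
    fix \<omega> assume "\<omega> \<in> space M"
    then have W: "0 < W \<omega>" by (rule W_pos)
    then have "rem (W \<omega> * s) / (W \<omega> * s) < rem (W \<omega> * t) / (W \<omega> * t)"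
      using assms by (intro rem_slope_strict_mono) auto
    \<comment> \<open>The factor \<open>W\<^sup>2\<close> turns slopes of \<open>rem\<close> in
      \<open>W * m\<close> into slopes in \<open>m\<close> of the integrand of
      \<open>gap\<close>.\<close>
    then have "W \<omega> ^ 2 * (rem (W \<omega> * s) / (W \<omega> * s)) < W \<omega> ^ 2 * (rem (W \<omega> * t) / (W \<omega> * t))"
      by (rule mult_strict_left_mono) (use W in simp)
    then show "0 < W \<omega> * rem (W \<omega> * t + 0) / t - W \<omega> * rem (W \<omega> * s + 0) / s"
      using W by (simp add: power2_eq_square)
  qed (use assms int in auto)
  also have "\<dots> = gap 0 t / t - gap 0 s / s"
    using int[of s] int[of t] assms by (simp add: gap_def)
  finally show ?thesis by simp
qed

lemma gap_le_integral:
  assumes "0 \<le> m" "0 \<le> h" "integrable M f" "\<And>\<omega>. \<omega> \<in> space M \<Longrightarrow> W \<omega> * rem (W \<omega> * m + h) \<le> f \<omega>"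
  shows "gap h m \<le> (\<integral>\<omega>. f \<omega> \<partial>M)"
  unfolding gap_def by (rule integral_mono) (use assms gap_integrable in auto)

text \<open>The field \<open>h\<close> is separated from \<open>W * m\<close> at the cost of
  doubling the arguments of \<open>rem\<close>. Its own contribution is of order
  \<open>h ^ (k - 1)\<close>, uniformly in \<open>m\<close>.\<close>

lemma gap_bounds:
  obtains c C where "0 < c" "0 < C"
    "\<And>m. 0 \<le> m \<Longrightarrow> c * (m * truncated_moment p m) \<le> gap 0 m"
    "\<And>m. 0 \<le> m \<Longrightarrow> gap 0 m \<le> C * (m * truncated_moment p m)"
    "\<And>m h. 0 \<le> m \<Longrightarrow> 0 \<le> h \<Longrightarrow> gap h m \<le> C * (m * truncated_moment p m) + EW * (C * h * h ^ p)"
proof -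
  obtain c C where cC: "0 < c" "0 < C"
    "\<And>t. 0 \<le> t \<Longrightarrow> c * (t * min (t ^ p) 1) \<le> rem t"
    "\<And>t. 0 \<le> t \<Longrightarrow> rem t \<le> C * (t * min (t ^ p) 1)"
    using rem_bounds by blast
  \<comment> \<open>Doubling the argument multiplies the linear factor by \<open>2\<close> and the
    truncated power by at most \<open>2 ^ p\<close>.\<close>
  define D where "D = C * 2 * 2 ^ p"
  have "1 \<le> 2 * (2::real) ^ p" using one_le_power[of "2::real" p] by linarith
  then have D: "C \<le> D" using cC(2) mult_left_mono[of 1 "2 * (2::real) ^ p" C] by (simp add: D_def)
  have tm: "(\<integral>\<omega>. K * m * (W \<omega> ^ 2 * min ((W \<omega> * m) ^ p) 1) \<partial>M) = K * (m * truncated_moment p m)" for K m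
    by (simp add: truncated_moment_def)
  have lower: "c * (m * truncated_moment p m) \<le> gap 0 m" if "0 \<le> m" for m
    unfolding tm[symmetric] gap_def
  proof (rule integral_mono)
    fix \<omega> assume "\<omega> \<in> space M"
    then have W: "0 < W \<omega>" by (rule W_pos)
    then have "W \<omega> * (c * (W \<omega> * m * min ((W \<omega> * m) ^ p) 1)) \<le> W \<omega> * rem (W \<omega> * m)"
      using that by (intro mult_left_mono cC) auto
    then show "c * m * (W \<omega> ^ 2 * min ((W \<omega> * m) ^ p) 1) \<le> W \<omega> * rem (W \<omega> * m + 0)"
      by (simp add: power2_eq_square mult_ac)
  qed (use that truncated_integrable gap_integrable[of m 0] in auto)
  have upper: "gap h m \<le> D * (m * truncated_moment p m) + EW * (D * h * h ^ p)"
    if m: "0 \<le> m" and h: "0 \<le> h" for m h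
  proof -
    have dbl: "rem (2 * t) \<le> D * (t * min (t ^ p) 1)" if t: "0 \<le> t" for t
    proof -
      have "min ((2 * t) ^ p) 1 \<le> 2 ^ p * min (t ^ p) 1"
      proof (cases "t ^ p \<le> 1")
        case True
        then show ?thesis by (simp add: power_mult_distrib)
      next
        case False
        have "min ((2 * t) ^ p) 1 \<le> 2 ^ p * 1" by (simp add: min.coboundedI2)
        with False show ?thesis by simp
      qed
      then have "C * (2 * t * min ((2 * t) ^ p) 1) \<le> C * (2 * t * (2 ^ p * min (t ^ p) 1))"
        using t cC(2) by (intro mult_left_mono) auto
      with cC(4)[of "2 * t"] t show ?thesis by (simp add: D_def mult_ac)
    qed
    have sum: "rem (a + b) \<le> D * (a * min (a ^ p) 1) + D * b * b ^ p" if "0 \<le> a" "0 \<le> b" for a b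
    proof -
      have "rem (a + b) \<le> rem (2 * max a b)" using that by (intro rem_mono) auto
      also have "\<dots> \<le> rem (2 * a) + rem (2 * b)"
        using that rem_nonneg[of "2 * a"] rem_nonneg[of "2 * b"] by (auto simp: max_def)
      also have "\<dots> \<le> D * (a * min (a ^ p) 1) + D * (b * min (b ^ p) 1)"
        using that by (intro add_mono dbl)
      \<comment> \<open>For the term in \<open>h\<close> the truncation is dropped, since only small
        \<open>h\<close> matters later.\<close>
      also have "D * (b * min (b ^ p) 1) \<le> D * (b * b ^ p)"
        using that D cC by (intro mult_left_mono) auto
      finally show ?thesis by (simp add: mult_ac)
    qed
    have "gap h m \<le> (\<integral>\<omega>. D * m * (W \<omega> ^ 2 * min ((W \<omega> * m) ^ p) 1) + (D * h * h ^ p) * W \<omega> \<partial>M)"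
    proof (rule gap_le_integral[OF m h])
      fix \<omega> assume "\<omega> \<in> space M"
      then have W: "0 < W \<omega>" by (rule W_pos)
      then have "W \<omega> * rem (W \<omega> * m + h) \<le> W \<omega> * (D * (W \<omega> * m * min ((W \<omega> * m) ^ p) 1) + D * h * h ^ p)"
        using m h by (intro mult_left_mono sum) auto
      then show "W \<omega> * rem (W \<omega> * m + h) \<le> D * m * (W \<omega> ^ 2 * min ((W \<omega> * m) ^ p) 1) + (D * h * h ^ p) * W \<omega>"
        by (simp add: algebra_simps power2_eq_square)
    qed (use m truncated_integrable[of m] integrable_W in auto)
    also have "\<dots> = D * (m * truncated_moment p m) + EW * (D * h * h ^ p)"
      using truncated_integrable[OF m] integrable_W by (subst Bochner_Integration.integral_add) (auto simp: truncated_moment_def)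
    finally show ?thesis .
  qed
  show thesis
  proof (rule that[of c D])
    show "gap 0 m \<le> D * (m * truncated_moment p m)" if "0 \<le> m" for m
      using upper[OF that, of 0] by simp
  qed (use lower upper cC D in auto)
qed

section \<open>Solutions of the mean-field equations and their asymptotics\<close>

definition m_zero :: "real \<Rightarrow> real" where "m_zero \<theta> = (THE m. m > 0 \<and> m / \<theta> = phi 0 m)"
definition m_crit :: "real \<Rightarrow> real" where "m_crit h = (THE m. m \<ge> 0 \<and> m / crit = phi h m)"

text \<open>For \<open>m > 0\<close> the equation says that \<open>gap 0 m / m\<close> equals the
  constant \<open>d\<close>. This slope is strictly increasing, whence uniqueness; it lies below
  \<open>d\<close> near \<open>0\<close> because the truncated moment tends to \<open>0\<close>,
  whence existence.\<close>

lemma m_zero: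
  assumes tm: "(truncated_moment p \<longlongrightarrow> 0) (at_right 0)" and \<theta>: "crit < \<theta>"
  shows "0 < m_zero \<theta>" "gap 0 (m_zero \<theta>) = EW * (1 / crit - 1 / \<theta>) * m_zero \<theta>"
proof -
  define d where "d = EW * (1 / crit - 1 / \<theta>)"
  have "0 < \<theta>" using crit_pos \<theta> by simp
  then have d: "0 < d" using crit_pos mean_pos \<theta> by (simp add: d_def field_simps)
  have iff: "m / \<theta> = phi 0 m \<longleftrightarrow> gap 0 m = d * m" "m / \<theta> \<le> phi 0 m \<longleftrightarrow> gap 0 m \<le> d * m" if "0 \<le> m" for m
  proof -
    have "phi 0 m - m / \<theta> = (d * m - gap 0 m) / EW"
      using that mean_pos by (simp add: phi_eq d_def field_simps)
    moreover have "(d * m - gap 0 m) / EW = 0 \<longleftrightarrow> d * m - gap 0 m = 0"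
      "0 \<le> (d * m - gap 0 m) / EW \<longleftrightarrow> 0 \<le> d * m - gap 0 m"
      using mean_pos by (auto simp: zero_le_divide_iff)
    ultimately show "m / \<theta> = phi 0 m \<longleftrightarrow> gap 0 m = d * m" "m / \<theta> \<le> phi 0 m \<longleftrightarrow> gap 0 m \<le> d * m" by linarith+
  qed
  obtain c C where cC: "0 < c" "0 < C" "\<And>m. 0 \<le> m \<Longrightarrow> c * (m * truncated_moment p m) \<le> gap 0 m"
    "\<And>m. 0 \<le> m \<Longrightarrow> gap 0 m \<le> C * (m * truncated_moment p m)"
    "\<And>m h. 0 \<le> m \<Longrightarrow> 0 \<le> h \<Longrightarrow> gap h m \<le> C * (m * truncated_moment p m) + EW * (C * h * h ^ p)"
    by (fact gap_bounds)
  \<comment> \<open>Provides a positive starting point \<open>a\<close> at which the map is above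
    the line.\<close>
  have "\<forall>\<^sub>F m in at_right 0. truncated_moment p m < d / C"
    using order_tendstoD(2)[OF tm] d cC by simp
  moreover have "\<forall>\<^sub>F m in at_right 0. (0::real) < m" by (simp add: eventually_at_right_less)
  ultimately have "\<forall>\<^sub>F m in at_right 0. 0 < m \<and> truncated_moment p m < d / C" by eventually_elim simp
  then obtain a where a: "0 < a" "truncated_moment p a < d / C"
    using eventually_happens'[OF trivial_limit_at_right_real] by blast
  then have "C * truncated_moment p a \<le> d" using cC by (simp add: field_simps)
  then have "a * (C * truncated_moment p a) \<le> a * d" by (rule mult_left_mono) (use a in simp)
  with order_trans[OF cC(4)[of a]] a have "gap 0 a \<le> d * a" by (metis less_imp_le mult.commute mult.left_commute)
  then obtain m where m: "a \<le> m" "m / \<theta> = phi 0 m"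
    using phi_fixpoint_exists[of \<theta> 0 a] \<open>0 < \<theta>\<close> a iff by auto
  have "m_zero \<theta> = m"
    unfolding m_zero_def
  proof (rule the_equality)
    fix m' assume m': "0 < m' \<and> m' / \<theta> = phi 0 m'"
    then have "gap 0 m' / m' = gap 0 m / m" using m a iff(1)[of m] iff(1)[of m'] by simp
    then show "m' = m"
      using gap_slope_strict_mono[of m m'] gap_slope_strict_mono[of m' m] m a m' by (cases m m' rule: linorder_cases) auto
  qed (use m a in auto)
  with m a iff[of m] show "0 < m_zero \<theta>" "gap 0 (m_zero \<theta>) = EW * (1 / crit - 1 / \<theta>) * m_zero \<theta>"
    by (simp_all add: d_def)
qed

text \<open>At the critical value the terms linear in \<open>m\<close> cancel, and the remaining
  \<open>gap h\<close> is strictly increasing. The search for a solution may start at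
  \<open>0\<close>, since \<open>phi h\<close> is nonnegative there.\<close>

lemma m_crit:
  assumes h: "0 < h"
  shows "0 \<le> m_crit h" "gap h (m_crit h) = EW * (\<kappa> 2 0 * h)"
proof -
  have iff: "m / crit = phi h m \<longleftrightarrow> gap h m = EW * (\<kappa> 2 0 * h)" if "0 \<le> m" for m
    using that h mean_pos by (auto simp: phi_eq field_simps)
  obtain m where m: "0 \<le> m" "m / crit = phi h m"
    using phi_fixpoint_exists[of crit h 0] crit_pos h phi_bounds(1)[of 0 h] by auto
  have "m_crit h = m"
    unfolding m_crit_def
  proof (rule the_equality)
    fix m' assume m': "0 \<le> m' \<and> m' / crit = phi h m'"
    then have "gap h m' = gap h m" using m iff[of m] iff[of m'] by simp
    then show "m' = m"
      using gap_strict_mono[of h m m'] gap_strict_mono[of h m' m] m m' h by (cases m m' rule: linorder_cases) auto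
  qed (use m in auto)
  with m iff[of m] show "0 \<le> m_crit h" "gap h (m_crit h) = EW * (\<kappa> 2 0 * h)" by simp_all
qed

text \<open>Dividing the equation by \<open>m_zero \<theta>\<close> places \<open>d \<theta>\<close>
  between two multiples of the truncated moment.\<close>

lemma m_zero_asymp:
  assumes tm: "(truncated_moment p \<longlongrightarrow> 0) (at_right 0)"
  shows "filterlim m_zero (at_right 0) (at_right crit)"
    and "(\<lambda>\<theta>. \<theta> - crit) \<in> \<Theta>[at_right crit](\<lambda>\<theta>. truncated_moment p (m_zero \<theta>))"
proof -
  obtain c C where cC: "0 < c" "0 < C" "\<And>m. 0 \<le> m \<Longrightarrow> c * (m * truncated_moment p m) \<le> gap 0 m"
    "\<And>m. 0 \<le> m \<Longrightarrow> gap 0 m \<le> C * (m * truncated_moment p m)"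
    "\<And>m h. 0 \<le> m \<Longrightarrow> 0 \<le> h \<Longrightarrow> gap h m \<le> C * (m * truncated_moment p m) + EW * (C * h * h ^ p)"
    by (fact gap_bounds)
  define d where "d \<theta> = EW * (1 / crit - 1 / \<theta>)" for \<theta>
  have right: "\<forall>\<^sub>F \<theta> in at_right crit. crit < \<theta>" by (simp add: eventually_at_right_less)
  then have ev: "\<forall>\<^sub>F \<theta> in at_right crit. 0 < m_zero \<theta> \<and> 0 < d \<theta> \<and> c * truncated_moment p (m_zero \<theta>) \<le> d \<theta>
      \<and> d \<theta> \<le> C * truncated_moment p (m_zero \<theta>)"
  proof eventually_elim
    case (elim \<theta>)
    note m = m_zero[OF tm elim]
    have "c * truncated_moment p (m_zero \<theta>) * m_zero \<theta> \<le> d \<theta> * m_zero \<theta>"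
      "d \<theta> * m_zero \<theta> \<le> C * truncated_moment p (m_zero \<theta>) * m_zero \<theta>"
      using cC(3,4)[of "m_zero \<theta>"] m by (simp_all add: d_def mult_ac)
    moreover have "0 < d \<theta>" using crit_pos mean_pos elim by (simp add: d_def field_simps)
    ultimately show ?case using m(1) by simp
  qed
  have d0: "(d \<longlongrightarrow> 0) (at_right crit)"
  proof -
    have "(d \<longlongrightarrow> EW * (1 / crit - 1 / crit)) (at_right crit)"
      unfolding d_def using crit_pos by (intro tendsto_intros) auto
    then show ?thesis by simp
  qed
  show "filterlim m_zero (at_right 0) (at_right crit)"
  proof (rule mono_bound_filterlim_at_right_0[OF _ _ _ _ d0, of "\<lambda>m. c * truncated_moment p m"])
    show "c * truncated_moment p s \<le> c * truncated_moment p t" if "0 < s" "s \<le> t" for s t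
      using that cC by (intro mult_left_mono truncated_moment_mono) auto
    show "0 < c * truncated_moment p t" if "0 < t" for t
      using cC truncated_moment_pos[OF that] by simp
    show "\<forall>\<^sub>F \<theta> in at_right crit. 0 < m_zero \<theta>" using ev by eventually_elim simp
    show "\<forall>\<^sub>F \<theta> in at_right crit. c * truncated_moment p (m_zero \<theta>) \<le> d \<theta>"
      using ev by eventually_elim simp
  qed
  have d: "d \<in> \<Theta>[at_right crit](\<lambda>\<theta>. truncated_moment p (m_zero \<theta>))"
  proof (rule bigthetaI'[OF cC(1,2)], use ev in eventually_elim)
    case (elim \<theta>)
    with truncated_moment_pos[of "m_zero \<theta>" p] show ?case by simp
  qed
  have "(\<lambda>\<theta>. \<theta> - crit) \<in> \<Theta>[at_right crit](d)"
  proof (rule bigthetaI_tendsto)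
    \<comment> \<open>\<open>\<theta> * crit / EW\<close> is the exact quotient of
      \<open>\<theta> - crit\<close> and \<open>d \<theta>\<close>.\<close>
    have "((\<lambda>\<theta>. \<theta> * crit / EW) \<longlongrightarrow> crit * crit / EW) (at_right crit)"
      using mean_pos by (intro tendsto_intros) auto
    then show "((\<lambda>\<theta>. (\<theta> - crit) / d \<theta>) \<longlongrightarrow> crit * crit / EW) (at_right crit)"
    proof (rule Lim_transform_eventually)
      show "\<forall>\<^sub>F \<theta> in at_right crit. \<theta> * crit / EW = (\<theta> - crit) / d \<theta>"
        using right
      proof eventually_elim
        case (elim \<theta>)
        then have "d \<theta> = EW * (\<theta> - crit) / (\<theta> * crit)" using crit_pos by (simp add: d_def field_simps)
        then show ?case using elim by simp
      qed
    qed
  qed (use crit_pos mean_pos in auto)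
  then show "(\<lambda>\<theta>. \<theta> - crit) \<in> \<Theta>[at_right crit](\<lambda>\<theta>. truncated_moment p (m_zero \<theta>))"
    by (rule landau_theta.trans[OF _ d])
qed

text \<open>The lower bound on \<open>h\<close> drops the field from \<open>gap\<close>. For the
  upper bound, the term of order \<open>h ^ (k - 1)\<close> is absorbed into the side linear in
  \<open>h\<close>.\<close>

lemma m_crit_asymp:
  shows "filterlim m_crit (at_right 0) (at_right 0)"
    and "(\<lambda>h. h) \<in> \<Theta>[at_right 0](\<lambda>h. m_crit h * truncated_moment p (m_crit h))"
proof -
  obtain c C where cC: "0 < c" "0 < C" "\<And>m. 0 \<le> m \<Longrightarrow> c * (m * truncated_moment p m) \<le> gap 0 m"
    "\<And>m. 0 \<le> m \<Longrightarrow> gap 0 m \<le> C * (m * truncated_moment p m)"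
    "\<And>m h. 0 \<le> m \<Longrightarrow> 0 \<le> h \<Longrightarrow> gap h m \<le> C * (m * truncated_moment p m) + EW * (C * h * h ^ p)"
    by (fact gap_bounds)
  define K where "K = EW * \<kappa> 2 0"
  have K: "0 < K" using mean_pos kappa2_pos by (simp add: K_def)
  have "((\<lambda>h. h ^ p) \<longlongrightarrow> 0 ^ p) (at_right (0::real))" by (intro tendsto_intros)
  then have "((\<lambda>h::real. h ^ p) \<longlongrightarrow> 0) (at_right 0)" using k_ge_3 by (simp add: zero_power)
  \<comment> \<open>Below this threshold the term in \<open>h ^ p\<close> takes up at most half of
    \<open>K * h\<close>; this is the origin of the factor \<open>2\<close> in the upper
    constant.\<close>
  then have "\<forall>\<^sub>F h in at_right (0::real). h ^ p < \<kappa> 2 0 / (2 * C)"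
    using cC kappa2_pos by (intro order_tendstoD(2)) auto
  moreover have "\<forall>\<^sub>F h in at_right (0::real). 0 < h" by (simp add: eventually_at_right_less)
  ultimately have ev: "\<forall>\<^sub>F h in at_right 0. 0 < h \<and> 0 < m_crit h
      \<and> c / K * (m_crit h * truncated_moment p (m_crit h)) \<le> h
      \<and> h \<le> 2 * C / K * (m_crit h * truncated_moment p (m_crit h))"
  proof eventually_elim
    case (elim h)
    note m = m_crit[OF elim(2)]
    let ?T = "m_crit h * truncated_moment p (m_crit h)"
    have "gap 0 (m_crit h) \<le> gap h (m_crit h)"
      unfolding gap_def
    proof (rule integral_mono)
      fix \<omega> assume "\<omega> \<in> space M"
      then have W: "0 < W \<omega>" by (rule W_pos)
      then show "W \<omega> * rem (W \<omega> * m_crit h + 0) \<le> W \<omega> * rem (W \<omega> * m_crit h + h)"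
        using m elim by (intro mult_left_mono rem_mono) auto
    qed (use m elim gap_integrable[of "m_crit h" 0] gap_integrable[of "m_crit h" h] in auto)
    with cC(3)[of "m_crit h"] m have 1: "c * ?T \<le> K * h" by (simp add: K_def mult_ac)
    have "C * h ^ p \<le> \<kappa> 2 0 / 2" using elim cC by (simp add: field_simps)
    then have "EW * h * (C * h ^ p) \<le> EW * h * (\<kappa> 2 0 / 2)"
      using mean_pos elim by (intro mult_left_mono) auto
    then have "EW * (C * h * h ^ p) \<le> K * h / 2" by (simp add: K_def mult_ac)
    moreover have "K * h \<le> C * ?T + EW * (C * h * h ^ p)"
      using cC(5)[of "m_crit h" h] m elim by (simp add: K_def mult_ac)
    ultimately have 2: "K * h \<le> 2 * C * ?T" by linarith
    have "m_crit h \<noteq> 0"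
    proof
      assume "m_crit h = 0"
      with 2 K elim have "K * h \<le> 0" by simp
      with mult_pos_pos[OF K elim(2)] show False by simp
    qed
    with 1 2 K m elim show ?case by (simp add: field_simps)
  qed
  show "filterlim m_crit (at_right 0) (at_right 0)"
  proof (rule mono_bound_filterlim_at_right_0[OF _ _ _ _ tendsto_ident_at, of "\<lambda>m. c / K * (m * truncated_moment p m)"])
    show "c / K * (s * truncated_moment p s) \<le> c / K * (t * truncated_moment p t)" if "0 < s" "s \<le> t" for s t
      using that cC K truncated_moment_pos[of s p]
      by (intro mult_left_mono mult_mono truncated_moment_mono) auto
    show "0 < c / K * (t * truncated_moment p t)" if "0 < t" for t
      using that cC K truncated_moment_pos[OF that] by simp
    show "\<forall>\<^sub>F h in at_right 0. 0 < m_crit h" using ev by eventually_elim simp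
    show "\<forall>\<^sub>F h in at_right 0. c / K * (m_crit h * truncated_moment p (m_crit h)) \<le> h"
      using ev by eventually_elim simp
  qed
  show "(\<lambda>h. h) \<in> \<Theta>[at_right 0](\<lambda>h. m_crit h * truncated_moment p (m_crit h))"
  proof (rule bigthetaI'[of "c / K" "2 * C / K"], use cC K in simp, use cC K in simp, use ev in eventually_elim)
    case (elim h)
    with truncated_moment_pos[of "m_crit h" p] show ?case by simp
  qed
qed

text \<open>The critical equation involves \<open>m * T m\<close> instead of \<open>T m\<close>,
  which adds \<open>1\<close> to the exponent to be inverted.\<close>

lemma power_exponents:
  assumes tm: "truncated_moment p \<in> \<Theta>[at_right 0](\<lambda>m. m powr s)" and s: "0 < s"
  shows "m_zero \<in> \<Theta>[at_right crit](\<lambda>\<theta>. (\<theta> - crit) powr (1 / s))"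
    and "m_crit \<in> \<Theta>[at_right 0](\<lambda>h. h powr (1 / (s + 1)))"
proof -
  have pos: "\<forall>\<^sub>F m in at_right (0::real). 0 < m" by (simp add: eventually_at_right_less)
  have "((\<lambda>m. m powr s) \<longlongrightarrow> 0) (at_right 0)" using s by real_asymp
  then have lim: "(truncated_moment p \<longlongrightarrow> 0) (at_right 0)"
    by (rule tendsto_0_bigtheta[OF tm])
  note z = m_zero_asymp[OF lim]
  note c = m_crit_asymp
  show "m_zero \<in> \<Theta>[at_right crit](\<lambda>\<theta>. (\<theta> - crit) powr (1 / s))"
  proof (rule powr_inversion[OF s])
    show "\<forall>\<^sub>F \<theta> in at_right crit. 0 < m_zero \<theta>" by (rule eventually_compose_filterlim[OF pos z(1)])
    show "\<forall>\<^sub>F \<theta> in at_right crit. 0 < \<theta> - crit"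
      using eventually_at_right_less[of crit] by eventually_elim simp
    show "(\<lambda>\<theta>. \<theta> - crit) \<in> \<Theta>[at_right crit](\<lambda>\<theta>. m_zero \<theta> powr s)"
      using z(2) landau_theta.compose[OF tm z(1)] by (rule landau_theta.trans)
  qed
  show "m_crit \<in> \<Theta>[at_right 0](\<lambda>h. h powr (1 / (s + 1)))"
  proof (rule powr_inversion[OF _ _ pos])
    show ev: "\<forall>\<^sub>F h in at_right 0. 0 < m_crit h" by (rule eventually_compose_filterlim[OF pos c(1)])
    have "(\<lambda>h. m_crit h * truncated_moment p (m_crit h)) \<in> \<Theta>[at_right 0](\<lambda>h. m_crit h * m_crit h powr s)"
      by (rule landau_theta.mult[OF bigtheta_refl landau_theta.compose[OF tm c(1)]])
    also have "(\<lambda>h. m_crit h * m_crit h powr s) \<in> \<Theta>[at_right 0](\<lambda>h. m_crit h powr (s + 1))"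
      by (rule bigthetaI_cong, use ev in eventually_elim) (simp add: powr_mult_base add.commute)
    finally show "(\<lambda>h. h) \<in> \<Theta>[at_right 0](\<lambda>h. m_crit h powr (s + 1))"
      by (rule landau_theta.trans[OF c(2)])
  qed (use s in simp)
qed

lemma log_exponents:
  assumes tm: "truncated_moment p \<in> \<Theta>[at_right 0](\<lambda>m. m powr s * ln (1 / m))" and s: "0 < s"
  shows "m_zero \<in> \<Theta>[at_right crit](\<lambda>\<theta>. ((\<theta> - crit) / ln (1 / (\<theta> - crit))) powr (1 / s))"
    and "m_crit \<in> \<Theta>[at_right 0](\<lambda>h. (h / ln (1 / h)) powr (1 / (s + 1)))"
proof -
  have pos: "\<forall>\<^sub>F m in at_right (0::real). 0 < m" by (simp add: eventually_at_right_less)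
  have "((\<lambda>m. m powr s * ln (1 / m)) \<longlongrightarrow> 0) (at_right 0)" using s by real_asymp
  then have lim: "(truncated_moment p \<longlongrightarrow> 0) (at_right 0)"
    by (rule tendsto_0_bigtheta[OF tm])
  note z = m_zero_asymp[OF lim]
  note c = m_crit_asymp
  show "m_zero \<in> \<Theta>[at_right crit](\<lambda>\<theta>. ((\<theta> - crit) / ln (1 / (\<theta> - crit))) powr (1 / s))"
  proof (rule powr_log_inversion[OF s z(1)])
    show "\<forall>\<^sub>F \<theta> in at_right crit. 0 < \<theta> - crit"
      using eventually_at_right_less[of crit] by eventually_elim simp
    show "(\<lambda>\<theta>. \<theta> - crit) \<in> \<Theta>[at_right crit](\<lambda>\<theta>. m_zero \<theta> powr s * ln (1 / m_zero \<theta>))"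
      using z(2) landau_theta.compose[OF tm z(1)] by (rule landau_theta.trans)
  qed
  show "m_crit \<in> \<Theta>[at_right 0](\<lambda>h. (h / ln (1 / h)) powr (1 / (s + 1)))"
  proof (rule powr_log_inversion[OF _ c(1) pos])
    have ev: "\<forall>\<^sub>F h in at_right 0. 0 < m_crit h" by (rule eventually_compose_filterlim[OF pos c(1)])
    have "(\<lambda>h. m_crit h * truncated_moment p (m_crit h)) \<in> \<Theta>[at_right 0](\<lambda>h. m_crit h * (m_crit h powr s * ln (1 / m_crit h)))"
      by (rule landau_theta.mult[OF bigtheta_refl landau_theta.compose[OF tm c(1)]])
    also have "(\<lambda>h. m_crit h * (m_crit h powr s * ln (1 / m_crit h))) \<in> \<Theta>[at_right 0](\<lambda>h. m_crit h powr (s + 1) * ln (1 / m_crit h))"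
      by (rule bigthetaI_cong, use ev in eventually_elim) (simp add: powr_add mult_ac)
    finally show "(\<lambda>h. h) \<in> \<Theta>[at_right 0](\<lambda>h. m_crit h powr (s + 1) * ln (1 / m_crit h))"
      by (rule landau_theta.trans[OF c(2)])
  qed (use s in simp)
qed

end

section \<open>Uniqueness of the exponents and application to the model\<close>

lemma is_beta_exponent_iff:
  assumes "is_beta_exponent A g M W b"
  shows "is_beta_exponent A g M W \<beta> \<longleftrightarrow> \<beta> = b"
  using assms powr_bigtheta_at_right_unique unfolding is_beta_exponent_def by blast

lemma is_delta_exponent_iff:
  assumes "is_delta_exponent A g M W d"
  shows "is_delta_exponent A g M W \<delta> \<longleftrightarrow> \<delta> = d"
proof
  assume "is_delta_exponent A g M W \<delta>"
  with assms powr_bigtheta_at_right_unique[of _ 0 "1 / \<delta>" "1 / d"] have "1 / \<delta> = 1 / d"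
    unfolding is_delta_exponent_def by simp
  \<comment> \<open>Division is total with \<open>1 / 0 = 0\<close>, so the reciprocal is injective
    on all reals, including \<open>\<delta> = 0\<close>.\<close>
  then show "\<delta> = d" by simp
qed (use assms in simp)

theorem theorem5p6:
  fixes \<alpha>\<^sub>0 :: "real measure" and g :: "real \<Rightarrow> real"
    and M :: "'w measure" and W :: "'w \<Rightarrow> real" and k :: nat
  assumes "even_prob_measure \<alpha>\<^sub>0"
    and "g \<in> borel_measurable (restrict_space borel {-1..1})"
    and "bounded (g ` {-1..1})"
    and "\<forall>\<sigma>\<in>{-1..1}. g (- \<sigma>) = - g \<sigma>"
    and "\<forall>\<sigma>\<in>{-1..1}. sgn (g \<sigma>) = sgn \<sigma>"
    and "\<forall>t>0. (deriv ^^ 3) (log_mgf \<alpha>\<^sub>0 g) t < 0"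
    and "(deriv ^^ k) (log_mgf \<alpha>\<^sub>0 g) 0 < 0"
    and "\<forall>j<k. \<not> (deriv ^^ j) (log_mgf \<alpha>\<^sub>0 g) 0 < 0"
    and "prob_space M"
    and "W \<in> borel_measurable M"
    and "\<forall>\<omega>\<in>space M. 0 < W \<omega>"
    and "integrable M (\<lambda>\<omega>. W \<omega> ^ 2)"
    and "integrable M (\<lambda>\<omega>. W \<omega> ^ k) \<or> (\<exists>\<tau>. 3 < \<tau> \<and> \<tau> \<le> real k + 1 \<and> power_law M W \<tau>)"
  shows "(integrable M (\<lambda>\<omega>. W \<omega> ^ k) \<longrightarrow>
            (\<forall>\<beta>. is_beta_exponent \<alpha>\<^sub>0 g M W \<beta> \<longleftrightarrow> \<beta> = 1 / (real k - 2)) \<and>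
            (\<forall>\<delta>. is_delta_exponent \<alpha>\<^sub>0 g M W \<delta> \<longleftrightarrow> \<delta> = real k - 1)) \<and>
         (\<forall>\<tau>. 3 < \<tau> \<and> \<tau> < real k + 1 \<and> power_law M W \<tau> \<longrightarrow>
            (\<forall>\<beta>. is_beta_exponent \<alpha>\<^sub>0 g M W \<beta> \<longleftrightarrow> \<beta> = 1 / (\<tau> - 3)) \<and>
            (\<forall>\<delta>. is_delta_exponent \<alpha>\<^sub>0 g M W \<delta> \<longleftrightarrow> \<delta> = \<tau> - 2)) \<and>
         (power_law M W (real k + 1) \<longrightarrow>
            (\<lambda>\<theta>. m_plus \<alpha>\<^sub>0 g M W \<theta> 0) \<in> \<Theta>[at_right (theta_c \<alpha>\<^sub>0 g M W)](\<lambda>\<theta>. ((\<theta> - theta_c \<alpha>\<^sub>0 g M W) / ln (1 / (\<theta> - theta_c \<alpha>\<^sub>0 g M W)))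
                     powr (1 / (real k - 2))) \<and>
            (\<lambda>h. m_plus \<alpha>\<^sub>0 g M W (theta_c \<alpha>\<^sub>0 g M W) h) \<in> \<Theta>[at_right 0](\<lambda>h. (h / ln (1 / h)) powr (1 / (real k - 1))))"
proof -
  let ?L = "log_mgf \<alpha>\<^sub>0 g"
  let ?\<kappa> = "\<lambda>n. (deriv ^^ n) ?L"
  interpret A: prob_space \<alpha>\<^sub>0 using assms(1) by (simp add: even_prob_measure_def)
  interpret M: prob_space M by fact
  have sets [measurable_cong]: "sets \<alpha>\<^sub>0 = sets (restrict_space borel {-1..1})"
    using assms(1) by (simp add: even_prob_measure_def)
  have space: "space \<alpha>\<^sub>0 = {-1..1}"
    using sets_eq_imp_space_eq[OF sets] by (simp add: space_restrict_space)
  have g [measurable]: "g \<in> borel_measurable \<alpha>\<^sub>0"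
    using assms(2) by (simp cong: measurable_cong_sets add: sets)
  obtain B where "\<forall>y\<in>g ` {-1..1}. norm y \<le> B" using assms(3) by (auto simp: bounded_iff)
  then have B: "\<And>\<sigma>. \<sigma> \<in> space \<alpha>\<^sub>0 \<Longrightarrow> \<bar>g \<sigma>\<bar> \<le> B" by (simp add: space)
  interpret A: bounded_observable \<alpha>\<^sub>0 g B by unfold_locales (use g B in auto)
  \<comment> \<open>The law is invariant under reflection and \<open>g\<close> is odd, so its mean
    equals its own negative.\<close>
  have "(\<integral>\<sigma>. g \<sigma> \<partial>\<alpha>\<^sub>0) = (\<integral>\<sigma>. g \<sigma> \<partial>(distr \<alpha>\<^sub>0 \<alpha>\<^sub>0 uminus))"
    using assms(1) by (simp add: even_prob_measure_def)
  also have "\<dots> = (\<integral>\<sigma>. g (- \<sigma>) \<partial>\<alpha>\<^sub>0)"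
  proof (rule integral_distr[OF _ g])
    have "uminus \<in> measurable (restrict_space borel {-1..1::real}) (restrict_space borel {-1..1})"
      by (intro measurable_restrict_space3) auto
    then show "uminus \<in> measurable \<alpha>\<^sub>0 \<alpha>\<^sub>0" by (simp cong: measurable_cong_sets add: sets)
  qed
  also have "\<dots> = (\<integral>\<sigma>. - g \<sigma> \<partial>\<alpha>\<^sub>0)"
    using assms(4) by (intro Bochner_Integration.integral_cong) (auto simp: space)
  finally have g0: "(\<integral>\<sigma>. g \<sigma> \<partial>\<alpha>\<^sub>0) = 0" by simp
  have m0: "exp_moment \<alpha>\<^sub>0 g 0 0 = 1" "exp_moment \<alpha>\<^sub>0 g 1 0 = 0" "exp_moment \<alpha>\<^sub>0 g 2 0 = (\<integral>\<sigma>. (g \<sigma>)\<^sup>2 \<partial>\<alpha>\<^sub>0)"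
    using g0 by (simp_all add: exp_moment_def A.prob_space)
  have k0: "?\<kappa> 0 0 = 0" using m0(1) by (simp add: log_mgf_def A.prob_space)
  have k1: "?\<kappa> 1 0 = 0" using m0 by (simp add: A.deriv_log_mgf)
  have k2: "?\<kappa> 2 0 = (\<integral>\<sigma>. (g \<sigma>)\<^sup>2 \<partial>\<alpha>\<^sub>0)" using m0 by (simp add: A.deriv2_log_mgf)
  \<comment> \<open>The derivatives of order 0 and 1 vanish at \<open>0\<close> and the second one
    is a second moment, so none of them is negative.\<close>
  have k3: "3 \<le> k"
  proof -
    have "0 \<le> ?\<kappa> 2 0" unfolding k2 by simp
    then have "k \<noteq> 0" "k \<noteq> 1" "k \<noteq> 2"
      using k0 k1 assms(7) by (metis not_less order_refl)+
    then show ?thesis by linarith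
  qed
  interpret mean_field M W ?\<kappa> k B
  proof unfold_locales
    show "\<And>n t. (?\<kappa> n has_real_derivative ?\<kappa> (Suc n) t) (at t)" by (rule A.log_mgf_higher_deriv)
    show "\<And>t. 0 \<le> t \<Longrightarrow> 0 \<le> ?\<kappa> 1 t" using A.deriv_log_mgf_nonneg[OF g0] by simp
    show "?\<kappa> 1 t \<le> B" for t using A.deriv_log_mgf_bounded[of t] by simp
    show "0 \<le> ?\<kappa> j 0" if "j < k" for j using assms(8) that by (meson not_less)
  qed (use assms k1 k3 in auto)
  have phi: "mean_field_map \<alpha>\<^sub>0 g M W h m = phi h m" for h m
    by (simp add: mean_field_map_def phi_def A.deriv_log_mgf exp_moment_def)
  have crit: "theta_c \<alpha>\<^sub>0 g M W = crit"
    unfolding theta_c_def crit_def k2 ..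
  have mz: "m_plus \<alpha>\<^sub>0 g M W \<theta> 0 = m_zero \<theta>" for \<theta>
    by (simp add: m_plus_def m_zero_def phi)
  \<comment> \<open>At \<open>h = 0\<close> the definition of \<open>m_plus\<close> takes its other
    branch, so the identification holds only off that point, which suffices for a right-hand
    limit.\<close>
  have mc: "\<forall>\<^sub>F h in at_right 0. m_plus \<alpha>\<^sub>0 g M W crit h = m_crit h"
    by (auto simp: m_plus_def m_crit_def phi eventually_at_filter)
  have beta: "is_beta_exponent \<alpha>\<^sub>0 g M W b \<longleftrightarrow> m_zero \<in> \<Theta>[at_right crit](\<lambda>\<theta>. (\<theta> - crit) powr b)" for b
    by (simp add: is_beta_exponent_def crit mz)
  have delta: "is_delta_exponent \<alpha>\<^sub>0 g M W d \<longleftrightarrow> m_crit \<in> \<Theta>[at_right 0](\<lambda>h. h powr (1 / d))" for d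
    unfolding is_delta_exponent_def crit by (rule landau_theta.in_cong[OF mc])
  have p: "0 < real p" "real p = real k - 2" "p + 2 = k" using k3 by auto
  \<comment> \<open>Used with \<open>s = k - 2\<close> for a finite moment and with
    \<open>s = \<tau> - 3\<close> for a power law.\<close>
  have power: "(\<forall>\<beta>. is_beta_exponent \<alpha>\<^sub>0 g M W \<beta> \<longleftrightarrow> \<beta> = 1 / s) \<and> (\<forall>\<delta>. is_delta_exponent \<alpha>\<^sub>0 g M W \<delta> \<longleftrightarrow> \<delta> = s + 1)"
    if "truncated_moment p \<in> \<Theta>[at_right 0](\<lambda>m. m powr s)" "0 < s" for s
    using power_exponents[OF that] is_beta_exponent_iff is_delta_exponent_iff unfolding beta[symmetric] delta[symmetric] by blast
  show ?thesis
  proof (intro conjI impI allI; (elim conjE)?)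
    assume "integrable M (\<lambda>\<omega>. W \<omega> ^ k)"
    then have tm: "truncated_moment p \<in> \<Theta>[at_right 0](\<lambda>m. m powr real p)"
      by (intro truncated_moment_integrable_case) (simp only: p(3))
    show "is_beta_exponent \<alpha>\<^sub>0 g M W \<beta> \<longleftrightarrow> \<beta> = 1 / (real k - 2)" for \<beta>
      using power[OF tm p(1)] p(2) by simp
    show "is_delta_exponent \<alpha>\<^sub>0 g M W \<delta> \<longleftrightarrow> \<delta> = real k - 1" for \<delta>
      using power[OF tm p(1)] p(2) by simp
  next
    fix \<tau> assume \<tau>: "3 < \<tau>" "\<tau> < real k + 1" "power_law M W \<tau>"
    then have tm: "truncated_moment p \<in> \<Theta>[at_right 0](\<lambda>m. m powr (\<tau> - 3))"
      using p(2) by (intro truncated_moment_power_law_case) auto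
    show "is_beta_exponent \<alpha>\<^sub>0 g M W \<beta> \<longleftrightarrow> \<beta> = 1 / (\<tau> - 3)" for \<beta>
      using power[OF tm] \<tau> by simp
    show "is_delta_exponent \<alpha>\<^sub>0 g M W \<delta> \<longleftrightarrow> \<delta> = \<tau> - 2" for \<delta>
      using power[OF tm] \<tau> by simp
  next
    assume "power_law M W (real k + 1)"
    moreover have "real k + 1 = real p + 3" using p(2) by simp
    ultimately have "truncated_moment p \<in> \<Theta>[at_right 0](\<lambda>m. m powr real p * ln (1 / m))"
      using p(1) by (intro truncated_moment_critical_case) simp_all
    note log = log_exponents[OF this p(1)]
    show "(\<lambda>\<theta>. m_plus \<alpha>\<^sub>0 g M W \<theta> 0) \<in> \<Theta>[at_right (theta_c \<alpha>\<^sub>0 g M W)](\<lambda>\<theta>. ((\<theta> - theta_c \<alpha>\<^sub>0 g M W) /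
        ln (1 / (\<theta> - theta_c \<alpha>\<^sub>0 g M W))) powr (1 / (real k - 2)))"
      using log(1) by (simp add: crit mz p(2))
    have "1 / (real p + 1) = 1 / (real k - 1)" using p(2) by simp
    with log(2) show "(\<lambda>h. m_plus \<alpha>\<^sub>0 g M W (theta_c \<alpha>\<^sub>0 g M W) h) \<in> \<Theta>[at_right 0](\<lambda>h. (h / ln (1 / h)) powr (1 / (real k - 1)))"
      unfolding crit landau_theta.in_cong[OF mc] by simp
  qed
qed

end
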